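(* There exists a functor $G\colon \overline{{\sf HBrcd}}\to {\sf 1C}$ acting on objects by sending $(H,B,\varphi_{B})$ to the 1-cocycle $u_{\varphi_{B}}\colon H\to B$, where $u_{\varphi_B}=\varphi_B\circ(H\otimes\eta_B)$ and $B$ is regarded as a left $H$-module algebra via $\Phi_B= \mu_{B}\circ((\lambda_{B}\circ u_{\varphi_{B}})\otimes\varphi_{B})\circ(\delta_{H}\otimes B)$, and on morphisms by the identity, i.e. $G((f,g))=(f,g)$.
   Context: ${\sf C}$ is a strict braided monoidal category with tensor product $\otimes$, unit object $K$ and braiding $c$. For an object $P$ and a morphism $f$, write $P\otimes f$ for $id_P\otimes f$ and $f\otimes P$ for $f\otimes id_P$. Algebras $(A,\eta_A,\mu_A)$, coalgebras $(D,\varepsilon_D,\delta_D)$, and Hopf algebras $X=(X,\eta_X,\mu_X,\varepsilon_X,\delta_X,\lambda_X)$ (with antipode $\lambda_X$) are taken in ${\sf C}$; tensor products have structures $\mu_{A\otimes B}=(\mu_A\otimes\mu_B)\circ(A\otimes c_{B,A}\otimes B)$ and $\delta_{D\otimes E}=(D\otimes c_{D,E}\otimes E)\circ(\delta_D\otimes\delta_E)$, with the obvious units and counits. A morphism of Hopf algebras is a morphism that is both an algebra and a coalgebra morphism. A Hopf bracoid in ${\sf C}$ is a triple $(H,B,\varphi_B)$ where $H,B$ are Hopf algebras in ${\sf C}$ and $(B,\varphi_B)$ is a left $H$-module such that $$\varphi_{B}\circ(H\otimes\mu_{B})=\mu_{B}\circ (\varphi_{B}\otimes\Phi_{B})\circ(H\otimes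 c_{H,B}\otimes B)\circ(\delta_{H}\otimes B\otimes B),$$ where $\Phi_{B}= \mu_{B}\circ((\lambda_{B}\circ u_{\varphi_{B}})\otimes\varphi_{B})\circ(\delta_{H}\otimes B)$ and $u_{\varphi_{B}}=\varphi_{B}\circ(H\otimes\eta_{B})$. A morphism of Hopf bracoids $(H,B,\varphi_B)\to(H',B',\varphi_{B'})$ is a pair $(f,g)$ of Hopf algebra morphisms $f\colon H\to H'$, $g\colon B\to B'$ with $g\circ\varphi_B=\varphi_{B'}\circ(f\otimes g)$. These form the category ${\sf HBrcd}$, and $\overline{{\sf HBrcd}}$ is its full subcategory of Hopf bracoids $(H,B,\varphi_B)$ such that $\varphi_B\colon H\otimes B\to B$ is a coalgebra morphism. For a Hopf algebra $X$, an algebra $A$ with a left $X$-module structure $\varphi_A$ is a left $X$-module algebra if $\varphi_A\circ(X\otimes\eta_A)=\varepsilon_X\otimes\eta_A$ and $\varphi_A\circ(X\otimes\mu_A)=\mu_A\circ(\varphi_A\otimes\varphi_A)\circ(X\otimes c_{X,A}\otimes A)\circ(\delta_X\otimes A\otimes A)$. A 1-cocycle in ${\sf C}$ consists of Hopf algebras $H,B$ in ${\sf C}$, a left $H$-module algebra structure $(B,\gamma_B)$, and a coalgebra morphism $\pi\colon H\to B$ such that $\mu_{B}\circ(\pi\otimes\gamma_{B})\circ(\delta_{H}\otimes\pi)=\pi\circ\mu_{H}$. A morphism of 1-cocycles from $\pi\colon H\to B$ to $\tau\colon H'\to B'$ is a pair $(f,g)$ of Hopf algebra morphisms $f\colon H\to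 H'$, $g\colon B\to B'$ with $\tau\circ f=g\circ\pi$ and $g\circ\gamma_B=\gamma_{B'}\circ(f\otimes g)$. These form the category ${\sf 1C}$. *)

theory Defs
  imports Main
begin

section \<open>Categories and functors\<close>

record ('o, 'a) category =
  Obj :: "'o set"
  Arr :: "'a set"
  Dom :: "'a \<Rightarrow> 'o"
  Cod :: "'a \<Rightarrow> 'o"
  Id :: "'o \<Rightarrow> 'a" ("\<iota>\<index> _" [91] 90)
  Comp :: "'a \<Rightarrow> 'a \<Rightarrow> 'a" (infixl "\<cdot>\<index>" 60)

definition hom :: "('o, 'a, 'm) category_scheme \<Rightarrow> 'o \<Rightarrow> 'o \<Rightarrow> 'a set" where
  "hom C a b = {f \<in> Arr C. Dom C f = a \<and> Cod C f = b}"

text \<open>Composition is only meaningful for composable arrows; its values elsewhere are irrelevant.\<close>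

locale category =
  fixes C :: "('o, 'a, 'm) category_scheme" (structure)
  assumes Dom_Obj: "f \<in> Arr C \<Longrightarrow> Dom C f \<in> Obj C"
    and Cod_Obj: "f \<in> Arr C \<Longrightarrow> Cod C f \<in> Obj C"
    and Id_hom: "a \<in> Obj C \<Longrightarrow> \<iota> a \<in> hom C a a"
    and Comp_hom: "\<lbrakk>f \<in> hom C a b; g \<in> hom C b c\<rbrakk> \<Longrightarrow> g \<cdot> f \<in> hom C a c"
    and Comp_Id: "f \<in> hom C a b \<Longrightarrow> f \<cdot> \<iota> a = f"
    and Id_Comp: "f \<in> hom C a b \<Longrightarrow> \<iota> b \<cdot> f = f"
    and Comp_assoc: "\<lbrakk>f \<in> hom C a b; g \<in> hom C b c; h \<in> hom C c d\<rbrakk>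
      \<Longrightarrow> (h \<cdot> g) \<cdot> f = h \<cdot> (g \<cdot> f)"

locale cat_functor = C: category C + D: category D
  for C :: "('o, 'a, 'm) category_scheme" and D :: "('p, 'b, 'n) category_scheme" +
  fixes Fo :: "'o \<Rightarrow> 'p" and Fa :: "'a \<Rightarrow> 'b"
  assumes Fo_Obj: "a \<in> Obj C \<Longrightarrow> Fo a \<in> Obj D"
    and Fa_hom: "f \<in> hom C a b \<Longrightarrow> Fa f \<in> hom D (Fo a) (Fo b)"
    and Fa_Id: "a \<in> Obj C \<Longrightarrow> Fa (Id C a) = Id D (Fo a)"
    and Fa_Comp: "\<lbrakk>f \<in> hom C a b; g \<in> hom C b c\<rbrakk>
      \<Longrightarrow> Fa (Comp C g f) = Comp D (Fa g) (Fa f)"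

definition full_subcategory :: "('o, 'a) category \<Rightarrow> ('o \<Rightarrow> bool) \<Rightarrow> ('o, 'a) category" where
  "full_subcategory C P =
     C\<lparr>Obj := {a \<in> Obj C. P a}, Arr := {f \<in> Arr C. P (Dom C f) \<and> P (Cod C f)}\<rparr>"


section \<open>Strict braided monoidal categories\<close>

text \<open>\<open>\<odot>\<close> is the tensor product of objects and \<open>\<otimes>\<close> the tensor product of arrows.\<close>

record ('o, 'a) braided_category = "('o, 'a) category" +
  Tens_obj :: "'o \<Rightarrow> 'o \<Rightarrow> 'o" (infixl "\<odot>\<index>" 70)
  Unit_obj :: "'o" ("\<K>\<index>")
  Tens :: "'a \<Rightarrow> 'a \<Rightarrow> 'a" (infixl "\<otimes>\<index>" 70)
  Braid :: "'o \<Rightarrow> 'o \<Rightarrow> 'a"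

locale strict_monoidal_category = category C
  for C :: "('o, 'a, 'm) braided_category_scheme" (structure) +
  assumes Tens_Obj: "\<lbrakk>a \<in> Obj C; b \<in> Obj C\<rbrakk> \<Longrightarrow> a \<odot> b \<in> Obj C"
    and Unit_Obj: "\<K> \<in> Obj C"
    and Tens_hom: "\<lbrakk>f \<in> hom C a b; g \<in> hom C a' b'\<rbrakk> \<Longrightarrow> f \<otimes> g \<in> hom C (a \<odot> a') (b \<odot> b')"
    and Tens_Id: "\<lbrakk>a \<in> Obj C; b \<in> Obj C\<rbrakk> \<Longrightarrow> \<iota> a \<otimes> \<iota> b = \<iota> (a \<odot> b)"
    and Tens_Comp: "\<lbrakk>f \<in> hom C a b; g \<in> hom C b c; f' \<in> hom C a' b'; g' \<in> hom C b' c'\<rbrakk>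
      \<Longrightarrow> (g \<cdot> f) \<otimes> (g' \<cdot> f') = (g \<otimes> g') \<cdot> (f \<otimes> f')"
    and Tens_obj_assoc: "\<lbrakk>a \<in> Obj C; b \<in> Obj C; c \<in> Obj C\<rbrakk> \<Longrightarrow> (a \<odot> b) \<odot> c = a \<odot> (b \<odot> c)"
    and Tens_obj_Unit: "a \<in> Obj C \<Longrightarrow> a \<odot> \<K> = a"
    and Unit_Tens_obj: "a \<in> Obj C \<Longrightarrow> \<K> \<odot> a = a"
    and Tens_assoc: "\<lbrakk>f \<in> Arr C; g \<in> Arr C; h \<in> Arr C\<rbrakk> \<Longrightarrow> (f \<otimes> g) \<otimes> h = f \<otimes> (g \<otimes> h)"
    and Tens_Unit: "f \<in> Arr C \<Longrightarrow> f \<otimes> \<iota> \<K> = f"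
    and Unit_Tens: "f \<in> Arr C \<Longrightarrow> \<iota> \<K> \<otimes> f = f"

locale strict_braided_monoidal_category = strict_monoidal_category C
  for C :: "('o, 'a, 'm) braided_category_scheme" (structure) +
  assumes Braid_hom: "\<lbrakk>a \<in> Obj C; b \<in> Obj C\<rbrakk> \<Longrightarrow> Braid C a b \<in> hom C (a \<odot> b) (b \<odot> a)"
    and Braid_iso: "\<lbrakk>a \<in> Obj C; b \<in> Obj C\<rbrakk> \<Longrightarrow> \<exists>d \<in> hom C (b \<odot> a) (a \<odot> b).
      d \<cdot> Braid C a b = \<iota> (a \<odot> b) \<and> Braid C a b \<cdot> d = \<iota> (b \<odot> a)"
    and Braid_natural: "\<lbrakk>f \<in> hom C a a'; g \<in> hom C b b'\<rbrakk>
      \<Longrightarrow> (g \<otimes> f) \<cdot> Braid C a b = Braid C a' b' \<cdot> (f \<otimes> g)"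
    and Braid_Tens_right: "\<lbrakk>a \<in> Obj C; b \<in> Obj C; c \<in> Obj C\<rbrakk>
      \<Longrightarrow> Braid C a (b \<odot> c) = (\<iota> b \<otimes> Braid C a c) \<cdot> (Braid C a b \<otimes> \<iota> c)"
    and Braid_Tens_left: "\<lbrakk>a \<in> Obj C; b \<in> Obj C; c \<in> Obj C\<rbrakk>
      \<Longrightarrow> Braid C (a \<odot> b) c = (Braid C a c \<otimes> \<iota> b) \<cdot> (\<iota> a \<otimes> Braid C b c)"


section \<open>Algebras, coalgebras and Hopf algebras\<close>

text \<open>Algebras are triples \<open>(A, \<eta>, \<mu>)\<close> and coalgebras are triples \<open>(D, \<epsilon>, \<delta>)\<close>.\<close>

record ('o, 'a) hopf =
  ob :: 'o
  \<eta> :: 'a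
  \<mu> :: 'a
  \<epsilon> :: 'a
  \<delta> :: 'a
  antipode :: 'a

definition alg :: "('o, 'a) hopf \<Rightarrow> 'o \<times> 'a \<times> 'a" where
  "alg X = (ob X, \<eta> X, \<mu> X)"

definition coalg :: "('o, 'a) hopf \<Rightarrow> 'o \<times> 'a \<times> 'a" where
  "coalg X = (ob X, \<epsilon> X, \<delta> X)"

context
  fixes C :: "('o, 'a) braided_category" (structure)
begin

fun algebra :: "'o \<times> 'a \<times> 'a \<Rightarrow> bool" where
  "algebra (A, e, m) \<longleftrightarrow>
     A \<in> Obj C \<and> e \<in> hom C \<K> A \<and> m \<in> hom C (A \<odot> A) A \<and>
     m \<cdot> (e \<otimes> \<iota> A) = \<iota> A \<and> m \<cdot> (\<iota> A \<otimes> e) = \<iota> A \<and>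
     m \<cdot> (m \<otimes> \<iota> A) = m \<cdot> (\<iota> A \<otimes> m)"

fun algebra_morphism :: "'o \<times> 'a \<times> 'a \<Rightarrow> 'o \<times> 'a \<times> 'a \<Rightarrow> 'a \<Rightarrow> bool" where
  "algebra_morphism (A, e, m) (A', e', m') f \<longleftrightarrow>
     f \<in> hom C A A' \<and> f \<cdot> e = e' \<and> f \<cdot> m = m' \<cdot> (f \<otimes> f)"

fun coalgebra :: "'o \<times> 'a \<times> 'a \<Rightarrow> bool" where
  "coalgebra (D, e, d) \<longleftrightarrow>
     D \<in> Obj C \<and> e \<in> hom C D \<K> \<and> d \<in> hom C D (D \<odot> D) \<and>
     (e \<otimes> \<iota> D) \<cdot> d = \<iota> D \<and> (\<iota> D \<otimes> e) \<cdot> d = \<iota> D \<and>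
     (d \<otimes> \<iota> D) \<cdot> d = (\<iota> D \<otimes> d) \<cdot> d"

fun coalgebra_morphism :: "'o \<times> 'a \<times> 'a \<Rightarrow> 'o \<times> 'a \<times> 'a \<Rightarrow> 'a \<Rightarrow> bool" where
  "coalgebra_morphism (D, e, d) (D', e', d') f \<longleftrightarrow>
     f \<in> hom C D D' \<and> e' \<cdot> f = e \<and> d' \<cdot> f = (f \<otimes> f) \<cdot> d"

definition unit_coalg :: "'o \<times> 'a \<times> 'a" where
  "unit_coalg = (\<K>, \<iota> \<K>, \<iota> \<K>)"

fun tensor_coalg :: "'o \<times> 'a \<times> 'a \<Rightarrow> 'o \<times> 'a \<times> 'a \<Rightarrow> 'o \<times> 'a \<times> 'a" where
  "tensor_coalg (D, e, d) (E, e', d') =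
     (D \<odot> E, e \<otimes> e', (\<iota> D \<otimes> Braid C D E \<otimes> \<iota> E) \<cdot> (d \<otimes> d'))"

text \<open>
  The two coalgebra-morphism conditions consist of exactly the same equations as the requirement
  that counit and comultiplication be algebra morphisms. By strictness, \<open>\<epsilon> X \<otimes> \<eta> X\<close>
  is an arrow from \<open>X = X \<odot> \<K>\<close> to \<open>X = \<K> \<odot> X\<close>.
\<close>

definition hopf_algebra :: "('o, 'a) hopf \<Rightarrow> bool" where
  "hopf_algebra X \<longleftrightarrow>
     algebra (alg X) \<and> coalgebra (coalg X) \<and>
     coalgebra_morphism unit_coalg (coalg X) (\<eta> X) \<and>
     coalgebra_morphism (tensor_coalg (coalg X) (coalg X)) (coalg X) (\<mu> X) \<and>
     antipode X \<in> hom C (ob X) (ob X) \<and>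
     \<mu> X \<cdot> (antipode X \<otimes> \<iota> (ob X)) \<cdot> \<delta> X = \<epsilon> X \<otimes> \<eta> X \<and>
     \<mu> X \<cdot> (\<iota> (ob X) \<otimes> antipode X) \<cdot> \<delta> X = \<epsilon> X \<otimes> \<eta> X"

definition hopf_morphism :: "('o, 'a) hopf \<Rightarrow> ('o, 'a) hopf \<Rightarrow> 'a \<Rightarrow> bool" where
  "hopf_morphism X Y f \<longleftrightarrow>
     algebra_morphism (alg X) (alg Y) f \<and> coalgebra_morphism (coalg X) (coalg Y) f"

definition left_module :: "('o, 'a) hopf \<Rightarrow> 'o \<Rightarrow> 'a \<Rightarrow> bool" where
  "left_module X M \<phi> \<longleftrightarrow>
     M \<in> Obj C \<and> \<phi> \<in> hom C (ob X \<odot> M) M \<and>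
     \<phi> \<cdot> (\<eta> X \<otimes> \<iota> M) = \<iota> M \<and>
     \<phi> \<cdot> (\<iota> (ob X) \<otimes> \<phi>) = \<phi> \<cdot> (\<mu> X \<otimes> \<iota> M)"

fun left_module_algebra :: "('o, 'a) hopf \<Rightarrow> 'o \<times> 'a \<times> 'a \<Rightarrow> 'a \<Rightarrow> bool" where
  "left_module_algebra X (A, e, m) \<phi> \<longleftrightarrow>
     algebra (A, e, m) \<and> left_module X A \<phi> \<and>
     \<phi> \<cdot> (\<iota> (ob X) \<otimes> e) = \<epsilon> X \<otimes> e \<and>
     \<phi> \<cdot> (\<iota> (ob X) \<otimes> m) =
       m \<cdot> (\<phi> \<otimes> \<phi>) \<cdot> (\<iota> (ob X) \<otimes> Braid C (ob X) A \<otimes> \<iota> A) \<cdot> (\<delta> X \<otimes> \<iota> A \<otimes> \<iota> A)"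


section \<open>Hopf bracoids and 1-cocycles\<close>

text \<open>
  Both categories have pairs \<open>(f, g)\<close> of Hopf algebra morphisms as morphisms, composed
  componentwise. So that an arrow determines its domain and codomain, the arrow \<open>(f, g)\<close> from
  \<open>X\<close> to \<open>Y\<close> is encoded as \<open>(X, (f, g), Y)\<close>. The argument \<open>HB\<close> projects an object to its
  two Hopf algebras \<open>(H, B)\<close>.
\<close>

definition pair_category ::
  "('x \<Rightarrow> ('o, 'a) hopf \<times> ('o, 'a) hopf) \<Rightarrow> ('x \<Rightarrow> bool) \<Rightarrow> ('x \<Rightarrow> 'x \<Rightarrow> 'a \<times> 'a \<Rightarrow> bool)
    \<Rightarrow> ('x, 'x \<times> ('a \<times> 'a) \<times> 'x) category" where
  "pair_category HB is_obj is_mor =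
    \<lparr>Obj = {X. is_obj X},
     Arr = {(X, fg, Y). is_obj X \<and> is_obj Y \<and> is_mor X Y fg},
     Dom = (\<lambda>(X, fg, Y). X),
     Cod = (\<lambda>(X, fg, Y). Y),
     Id = (\<lambda>X. (X, (\<iota> (ob (fst (HB X))), \<iota> (ob (snd (HB X)))), X)),
     Comp = (\<lambda>(Y, (f', g'), Z) (X, (f, g), _). (X, (f' \<cdot> f, g' \<cdot> g), Z))\<rparr>"

definition u_map :: "('o, 'a) hopf \<Rightarrow> ('o, 'a) hopf \<Rightarrow> 'a \<Rightarrow> 'a" where
  "u_map H B \<phi> = \<phi> \<cdot> (\<iota> (ob H) \<otimes> \<eta> B)"

definition Phi_map :: "('o, 'a) hopf \<Rightarrow> ('o, 'a) hopf \<Rightarrow> 'a \<Rightarrow> 'a" where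
  "Phi_map H B \<phi> = \<mu> B \<cdot> ((antipode B \<cdot> u_map H B \<phi>) \<otimes> \<phi>) \<cdot> (\<delta> H \<otimes> \<iota> (ob B))"

fun hopf_bracoid :: "('o, 'a) hopf \<times> ('o, 'a) hopf \<times> 'a \<Rightarrow> bool" where
  "hopf_bracoid (H, B, \<phi>) \<longleftrightarrow>
     hopf_algebra H \<and> hopf_algebra B \<and> left_module H (ob B) \<phi> \<and>
     \<phi> \<cdot> (\<iota> (ob H) \<otimes> \<mu> B) =
       \<mu> B \<cdot> (\<phi> \<otimes> Phi_map H B \<phi>) \<cdot> (\<iota> (ob H) \<otimes> Braid C (ob H) (ob B) \<otimes> \<iota> (ob B))
         \<cdot> (\<delta> H \<otimes> \<iota> (ob B) \<otimes> \<iota> (ob B))"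

fun bracoid_morphism :: "('o, 'a) hopf \<times> ('o, 'a) hopf \<times> 'a
    \<Rightarrow> ('o, 'a) hopf \<times> ('o, 'a) hopf \<times> 'a \<Rightarrow> 'a \<times> 'a \<Rightarrow> bool" where
  "bracoid_morphism (H, B, \<phi>) (H', B', \<phi>') (f, g) \<longleftrightarrow>
     hopf_morphism H H' f \<and> hopf_morphism B B' g \<and> g \<cdot> \<phi> = \<phi>' \<cdot> (f \<otimes> g)"

definition HBrcd where
  "HBrcd = pair_category (\<lambda>(H, B, \<phi>). (H, B)) hopf_bracoid bracoid_morphism"

definition HBrcd_bar where
  "HBrcd_bar = full_subcategory HBrcd
     (\<lambda>(H, B, \<phi>). coalgebra_morphism (tensor_coalg (coalg H) (coalg B)) (coalg B) \<phi>)"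

text \<open>A 1-cocycle \<open>\<pi> : H \<rightarrow> B\<close> with module algebra structure \<open>\<gamma>\<close> is the tuple \<open>(H, B, \<gamma>, \<pi>)\<close>.\<close>

fun one_cocycle :: "('o, 'a) hopf \<times> ('o, 'a) hopf \<times> 'a \<times> 'a \<Rightarrow> bool" where
  "one_cocycle (H, B, \<gamma>, \<pi>) \<longleftrightarrow>
     hopf_algebra H \<and> hopf_algebra B \<and> left_module_algebra H (alg B) \<gamma> \<and>
     coalgebra_morphism (coalg H) (coalg B) \<pi> \<and>
     \<mu> B \<cdot> (\<pi> \<otimes> \<gamma>) \<cdot> (\<delta> H \<otimes> \<pi>) = \<pi> \<cdot> \<mu> H"

fun cocycle_morphism :: "('o, 'a) hopf \<times> ('o, 'a) hopf \<times> 'a \<times> 'a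
    \<Rightarrow> ('o, 'a) hopf \<times> ('o, 'a) hopf \<times> 'a \<times> 'a \<Rightarrow> 'a \<times> 'a \<Rightarrow> bool" where
  "cocycle_morphism (H, B, \<gamma>, \<pi>) (H', B', \<gamma>', \<tau>) (f, g) \<longleftrightarrow>
     hopf_morphism H H' f \<and> hopf_morphism B B' g \<and>
     \<tau> \<cdot> f = g \<cdot> \<pi> \<and> g \<cdot> \<gamma> = \<gamma>' \<cdot> (f \<otimes> g)"

definition OneCocycle where
  "OneCocycle = pair_category (\<lambda>(H, B, \<gamma>, \<pi>). (H, B)) one_cocycle cocycle_morphism"

end

end

theory Submission
  imports Defs
begin

text \<open>
  For a coalgebra \<open>P\<close>, convolution lets arrows \<open>f : P \<rightarrow> B\<close> act on arrows \<open>\<Psi> : P \<otimes> M \<rightarrow> B\<close> by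
  \<open>f \<star> \<Psi> = \<mu> (f \<otimes> \<Psi>) (\<delta> \<otimes> M)\<close>, and if \<open>f\<close> is a coalgebra morphism, the actions of \<open>f\<close> and \<open>\<lambda> f\<close>
  are mutually inverse. Here \<open>\<Phi> = (\<lambda> u) \<star> \<phi>\<close>, so \<open>u \<star> \<Phi> = \<phi>\<close>. The module algebra laws for \<open>\<mu>\<close> and \<open>\<eta>\<close>
  follow by letting \<open>\<lambda> u\<close> act on the bracoid equation and on \<open>u\<close>; the cocycle equation is
  \<open>\<phi> (H \<otimes> u) = u \<mu>\<close>. For the module law it suffices to see that \<open>u \<mu>\<close>, a coalgebra morphism on
  \<open>H \<otimes> H\<close>, acts in the same way on both sides. In Sweedler notation, by the cocycle equation and
  multiplicativity of \<open>\<Phi>\<close>,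
  \<open>u (h\<^sub>1 k\<^sub>1) \<Phi> (h\<^sub>2, \<Phi> (k\<^sub>2, b)) = u (h\<^sub>1) \<Phi> (h\<^sub>2, u (k\<^sub>1) \<Phi> (k\<^sub>2, b)) = \<phi> (h, \<phi> (k, b)) = \<phi> (h k, b)\<close>.
  The same cancellation shows that Hopf algebra morphisms preserve antipodes, hence \<open>\<Phi>\<close>.
\<close>

section \<open>Arrows and the interchange law in a strict monoidal category\<close>

text \<open>The definitions of algebras, bracoids and cocycles only accept unextended records.\<close>

locale plain_braided_category = strict_braided_monoidal_category C
  for C :: "('o, 'a) braided_category" (structure)
begin

text \<open>Membership in a hom set is split into arrow, domain and codomain, because the simplifier
  computes these for composites and tensor products and so checks composability by itself.\<close>

lemma hom_iff: "f \<in> hom C a b \<longleftrightarrow> f \<in> Arr C \<and> Dom C f = a \<and> Cod C f = b"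
  by (simp add: hom_def)

lemma Id_Arr [simp]:
  assumes "a \<in> Obj C"
  shows "\<iota> a \<in> Arr C" "Dom C (\<iota> a) = a" "Cod C (\<iota> a) = a"
  using Id_hom [OF assms] by (auto simp: hom_iff)

lemma Comp_Arr [simp]:
  assumes "f \<in> Arr C" "g \<in> Arr C" "Dom C g = Cod C f"
  shows "g \<cdot> f \<in> Arr C" "Dom C (g \<cdot> f) = Dom C f" "Cod C (g \<cdot> f) = Cod C g"
  using Comp_hom [of f _ _ g] assms by (auto simp: hom_iff)

lemma Tens_Arr [simp]:
  assumes "f \<in> Arr C" "g \<in> Arr C"
  shows "f \<otimes> g \<in> Arr C" "Dom C (f \<otimes> g) = Dom C f \<odot> Dom C g"
    "Cod C (f \<otimes> g) = Cod C f \<odot> Cod C g"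
  using Tens_hom [of f _ _ g] assms by (auto simp: hom_iff)

lemma Braid_Arr [simp]:
  assumes "a \<in> Obj C" "b \<in> Obj C"
  shows "Braid C a b \<in> Arr C" "Dom C (Braid C a b) = a \<odot> b" "Cod C (Braid C a b) = b \<odot> a"
  using Braid_hom [OF assms] by (auto simp: hom_iff)

text \<open>Composites are kept nested to the right; steps that need another grouping use this rule
  backwards.\<close>

lemma Comp_assoc_Arr [simp]:
  assumes "f \<in> Arr C" "g \<in> Arr C" "h \<in> Arr C" "Dom C g = Cod C f" "Dom C h = Cod C g"
  shows "(h \<cdot> g) \<cdot> f = h \<cdot> (g \<cdot> f)"
  using Comp_assoc [of f _ _ g _ h] assms by (auto simp: hom_iff)

lemma Comp_Id' [simp]: "f \<in> Arr C \<Longrightarrow> Dom C f = a \<Longrightarrow> f \<cdot> \<iota> a = f"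
  using Comp_Id by (auto simp: hom_iff)

lemma Id_Comp' [simp]: "f \<in> Arr C \<Longrightarrow> Cod C f = a \<Longrightarrow> \<iota> a \<cdot> f = f"
  using Id_Comp by (auto simp: hom_iff)

lemma interchange:
  assumes "f \<in> Arr C" "f' \<in> Arr C" "g \<in> Arr C" "g' \<in> Arr C"
    "Dom C g = Cod C f" "Dom C g' = Cod C f'"
  shows "(g \<otimes> g') \<cdot> (f \<otimes> f') = (g \<cdot> f) \<otimes> (g' \<cdot> f')"
  using Tens_Comp [of f _ _ g _ f' _ _ g'] assms by (auto simp: hom_iff)

text \<open>In right-nested composites two adjacent tensor products usually have a further composite
  \<open>h\<close> to their right; this form merges them there.\<close>

lemma interchange_assoc:
  assumes "f \<in> Arr C" "f' \<in> Arr C" "g \<in> Arr C" "g' \<in> Arr C" "h \<in> Arr C"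
    "Dom C g = Cod C f" "Dom C g' = Cod C f'" "Cod C h = Dom C f \<odot> Dom C f'"
  shows "(g \<otimes> g') \<cdot> ((f \<otimes> f') \<cdot> h) = ((g \<cdot> f) \<otimes> (g' \<cdot> f')) \<cdot> h"
  using assms by (simp add: interchange flip: Comp_assoc_Arr)

declare Dom_Obj [simp] Cod_Obj [simp] Tens_Obj [simp] Unit_Obj [simp] Tens_obj_assoc [simp]
  Tens_obj_Unit [simp] Unit_Tens_obj [simp] Tens_Unit [simp] Unit_Tens [simp]

lemma Id_Tens: "\<lbrakk>a \<in> Obj C; b \<in> Obj C\<rbrakk> \<Longrightarrow> \<iota> (a \<odot> b) = \<iota> a \<otimes> \<iota> b"
  by (simp add: Tens_Id)

lemma Tens_assoc_sym: "\<lbrakk>f \<in> Arr C; g \<in> Arr C; h \<in> Arr C\<rbrakk> \<Longrightarrow> f \<otimes> (g \<otimes> h) = (f \<otimes> g) \<otimes> h"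
  by (simp add: Tens_assoc)

text \<open>Two tensor products merge only if both are split at the same object, and the bracketing
  decides the split: the first list splits off the leftmost factor, the second the rightmost.
  Identities on products are broken up so that they can follow either bracketing.\<close>

lemmas interchange_nested_right = interchange interchange_assoc Tens_assoc Id_Tens
lemmas interchange_nested_left = interchange interchange_assoc Tens_assoc_sym Id_Tens

section \<open>Convolution actions of arrows out of a coalgebra\<close>

text \<open>Since \<open>P \<odot> \<K> = P\<close>, the case \<open>M = \<K>\<close> is the convolution product on arrows \<open>P \<rightarrow> B\<close>.\<close>

definition star where "star m d M f \<Psi> = m \<cdot> ((f \<otimes> \<Psi>) \<cdot> (d \<otimes> \<iota> M))"

text \<open>Associativity of \<open>m\<close> and coassociativity of \<open>d\<close> make
  convolution an action. In Sweedler notation both sides are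
  \<open>f (h\<^sub>1) g (h\<^sub>2) \<Psi> (h\<^sub>3, x)\<close>, bracketed differently.\<close>

lemma star_assoc:
  assumes "B \<in> Obj C" "P \<in> Obj C" "M \<in> Obj C"
    "m \<in> hom C (B \<odot> B) B" "d \<in> hom C P (P \<odot> P)" "f \<in> hom C P B" "g \<in> hom C P B"
    "\<Psi> \<in> hom C (P \<odot> M) B"
    and m: "m \<cdot> (m \<otimes> \<iota> B) = m \<cdot> (\<iota> B \<otimes> m)"
    and d: "(d \<otimes> \<iota> P) \<cdot> d = (\<iota> P \<otimes> d) \<cdot> d"
  shows "star m d M f (star m d M g \<Psi>) = star m d M (m \<cdot> (f \<otimes> g) \<cdot> d) \<Psi>"
proof -
  note H = assms(1-8)
  have dM: "(\<iota> P \<otimes> d \<otimes> \<iota> M) \<cdot> (d \<otimes> \<iota> M) = (d \<otimes> \<iota> P \<otimes> \<iota> M) \<cdot> (d \<otimes> \<iota> M)"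
    using H d by (simp add: hom_iff interchange_nested_left)
  have "star m d M f (star m d M g \<Psi>)
      = (m \<cdot> (\<iota> B \<otimes> m)) \<cdot> ((f \<otimes> g \<otimes> \<Psi>) \<cdot> ((\<iota> P \<otimes> d \<otimes> \<iota> M) \<cdot> (d \<otimes> \<iota> M)))"
    using H by (simp add: hom_iff star_def interchange_nested_right)
  also have "\<dots> = (m \<cdot> (m \<otimes> \<iota> B)) \<cdot> ((f \<otimes> g \<otimes> \<Psi>) \<cdot> ((d \<otimes> \<iota> P \<otimes> \<iota> M) \<cdot> (d \<otimes> \<iota> M)))"
    by (simp only: m dM)
  also have "\<dots> = star m d M (m \<cdot> (f \<otimes> g) \<cdot> d) \<Psi>"
  proof -
    \<comment> \<open>The identities on \<open>P\<close> and \<open>M\<close> stay bracketed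
      together, since \<open>\<Psi>\<close> has domain \<open>P \<odot> M\<close> and must meet them
      as one block.\<close>
    have "(m \<cdot> (f \<otimes> g) \<cdot> d) \<otimes> \<Psi> = (m \<otimes> \<iota> B) \<cdot> ((f \<otimes> g \<otimes> \<Psi>) \<cdot> (d \<otimes> (\<iota> P \<otimes> \<iota> M)))"
      using H by (simp add: hom_iff interchange interchange_assoc Tens_Id)
    then show ?thesis
      using H by (simp add: hom_iff star_def Tens_assoc)
  qed
  finally show ?thesis .
qed

text \<open>\<open>i \<cdot> e\<close> is the convolution unit: once separated, \<open>e\<close>
  cancels against \<open>d\<close> and \<open>i\<close> against \<open>m\<close>.\<close>

lemma star_unit:
  assumes "B \<in> Obj C" "P \<in> Obj C" "M \<in> Obj C"
    "m \<in> hom C (B \<odot> B) B" "d \<in> hom C P (P \<odot> P)" "i \<in> hom C \<K> B" "e \<in> hom C P \<K>"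
    "\<Psi> \<in> hom C (P \<odot> M) B"
    and m: "m \<cdot> (i \<otimes> \<iota> B) = \<iota> B"
    and d: "(e \<otimes> \<iota> P) \<cdot> d = \<iota> P"
  shows "star m d M (i \<cdot> e) \<Psi> = \<Psi>"
proof -
  note H = assms(1-8)
  have dM: "(e \<otimes> \<iota> P \<otimes> \<iota> M) \<cdot> (d \<otimes> \<iota> M) = \<iota> P \<otimes> \<iota> M"
    using H d by (simp add: hom_iff interchange_nested_left)
  \<comment> \<open>With \<open>Unit_Tens\<close> disabled, \<open>\<iota> \<K>\<close> is not
    erased and serves as the partner of \<open>i\<close> in the interchange law.\<close>
  have *: "i \<otimes> \<Psi> = (i \<otimes> \<iota> B) \<cdot> (\<iota> \<K> \<otimes> \<Psi>)"
    using H by (simp add: hom_iff interchange del: Unit_Tens)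
  have **: "(i \<cdot> e) \<otimes> \<Psi> = (i \<otimes> \<Psi>) \<cdot> (e \<otimes> \<iota> P \<otimes> \<iota> M)"
    using H by (simp add: hom_iff interchange_nested_right flip: Id_Tens)
  have "star m d M (i \<cdot> e) \<Psi> = (m \<cdot> (i \<otimes> \<iota> B)) \<cdot> (\<Psi> \<cdot> ((e \<otimes> \<iota> P \<otimes> \<iota> M) \<cdot> (d \<otimes> \<iota> M)))"
    using H by (simp add: hom_iff star_def ** *)
  also have "\<dots> = \<Psi>"
    using H by (simp add: m dM hom_iff Tens_Id)
  finally show ?thesis .
qed

text \<open>A comultiplicative \<open>k\<close> passes through \<open>d\<close> and lands in both
  factors, while \<open>n\<close> only reaches \<open>\<Psi>\<close>. This changes the acting
  coalgebra from \<open>P\<close> to \<open>Q\<close> and the passive argument from \<open>M\<close>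
  to \<open>N\<close>.\<close>

lemma star_comp:
  assumes "B \<in> Obj C" "P \<in> Obj C" "M \<in> Obj C" "Q \<in> Obj C" "N \<in> Obj C"
    "m \<in> hom C (B \<odot> B) B" "d \<in> hom C P (P \<odot> P)" "d' \<in> hom C Q (Q \<odot> Q)"
    "f \<in> hom C P B" "\<Psi> \<in> hom C (P \<odot> M) B" "k \<in> hom C Q P" "n \<in> hom C N M"
    and k: "d \<cdot> k = (k \<otimes> k) \<cdot> d'"
  shows "star m d M f \<Psi> \<cdot> (k \<otimes> n) = star m d' N (f \<cdot> k) (\<Psi> \<cdot> (k \<otimes> n))"
proof -
  note H = assms(1-12)
  have dM: "(d \<otimes> \<iota> M) \<cdot> (k \<otimes> n) = (k \<otimes> k \<otimes> n) \<cdot> (d' \<otimes> \<iota> N)"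
    using H k by (simp add: hom_iff interchange_nested_left)
  have "star m d M f \<Psi> \<cdot> (k \<otimes> n) = m \<cdot> ((f \<otimes> \<Psi>) \<cdot> ((d \<otimes> \<iota> M) \<cdot> (k \<otimes> n)))"
    using H by (simp add: hom_iff star_def)
  also have "\<dots> = m \<cdot> ((f \<otimes> \<Psi>) \<cdot> ((k \<otimes> k \<otimes> n) \<cdot> (d' \<otimes> \<iota> N)))"
    by (simp only: dM)
  also have "\<dots> = star m d' N (f \<cdot> k) (\<Psi> \<cdot> (k \<otimes> n))"
    using H by (simp add: hom_iff star_def interchange_nested_right)
  finally show ?thesis .
qed

section \<open>Convolution products with two braided arguments\<close>

text \<open>\<open>(h, x, y) \<mapsto> \<alpha> (h\<^sub>1, x) \<beta> (h\<^sub>2, y)\<close> in Sweedler notation.\<close>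

definition theta where
  "theta m d P M N \<alpha> \<beta> =
    m \<cdot> ((\<alpha> \<otimes> \<beta>) \<cdot> ((\<iota> P \<otimes> Braid C P M \<otimes> \<iota> N) \<cdot> (d \<otimes> \<iota> M \<otimes> \<iota> N)))"

text \<open>Naturality of the braiding carries \<open>f\<close> across the strand \<open>P\<close>
  into \<open>\<alpha>\<close>; \<open>g\<close> reaches \<open>\<beta>\<close> without a
  crossing.\<close>

lemma theta_comp:
  assumes "B \<in> Obj C" "P \<in> Obj C" "M \<in> Obj C" "N \<in> Obj C" "M' \<in> Obj C" "N' \<in> Obj C"
    "m \<in> hom C (B \<odot> B) B" "d \<in> hom C P (P \<odot> P)"
    "\<alpha> \<in> hom C (P \<odot> M) B" "\<beta> \<in> hom C (P \<odot> N) B" "f \<in> hom C M' M" "g \<in> hom C N' N"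
  shows "theta m d P M N \<alpha> \<beta> \<cdot> (\<iota> P \<otimes> f \<otimes> g)
    = theta m d P M' N' (\<alpha> \<cdot> (\<iota> P \<otimes> f)) (\<beta> \<cdot> (\<iota> P \<otimes> g))"
proof -
  note H = assms
  have nat: "Braid C P M \<cdot> (\<iota> P \<otimes> f) = (f \<otimes> \<iota> P) \<cdot> Braid C P M'"
    using H Braid_natural [of "\<iota> P" P P f M' M] Id_hom by simp
  have *: "(\<iota> P \<otimes> Braid C P M \<otimes> \<iota> N) \<cdot> (\<iota> P \<otimes> (\<iota> P \<otimes> f) \<otimes> g)
      = (\<iota> P \<otimes> (f \<otimes> \<iota> P) \<otimes> g) \<cdot> (\<iota> P \<otimes> Braid C P M' \<otimes> \<iota> N')"
    using H by (simp add: hom_iff interchange nat)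
  have "theta m d P M N \<alpha> \<beta> \<cdot> (\<iota> P \<otimes> f \<otimes> g)
      = m \<cdot> ((\<alpha> \<otimes> \<beta>) \<cdot> (((\<iota> P \<otimes> Braid C P M \<otimes> \<iota> N) \<cdot> (\<iota> P \<otimes> (\<iota> P \<otimes> f) \<otimes> g))
          \<cdot> (d \<otimes> \<iota> M' \<otimes> \<iota> N')))"
  proof -
    have "(d \<otimes> \<iota> M \<otimes> \<iota> N) \<cdot> (\<iota> P \<otimes> f \<otimes> g) = (\<iota> P \<otimes> (\<iota> P \<otimes> f) \<otimes> g) \<cdot> (d \<otimes> \<iota> M' \<otimes> \<iota> N')"
      using H by (simp add: hom_iff interchange Tens_assoc_sym Tens_Id)
    then show ?thesis
      using H by (simp add: hom_iff theta_def)
  qed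
  also have "\<dots> = m \<cdot> ((\<alpha> \<otimes> \<beta>) \<cdot> ((((\<iota> P \<otimes> f) \<otimes> \<iota> P \<otimes> g) \<cdot> (\<iota> P \<otimes> Braid C P M' \<otimes> \<iota> N'))
          \<cdot> (d \<otimes> \<iota> M' \<otimes> \<iota> N')))"
    using H by (subst *) (simp add: Tens_assoc hom_iff)
  also have "\<dots> = theta m d P M' N' (\<alpha> \<cdot> (\<iota> P \<otimes> f)) (\<beta> \<cdot> (\<iota> P \<otimes> g))"
  proof -
    have "(\<alpha> \<otimes> \<beta>) \<cdot> ((\<iota> P \<otimes> f) \<otimes> (\<iota> P \<otimes> g)) = (\<alpha> \<cdot> (\<iota> P \<otimes> f)) \<otimes> (\<beta> \<cdot> (\<iota> P \<otimes> g))"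
      using H by (simp add: hom_iff interchange)
    moreover have "(\<iota> P \<otimes> f) \<otimes> \<iota> P \<otimes> g = (\<iota> P \<otimes> f) \<otimes> (\<iota> P \<otimes> g)"
      using H by (simp add: hom_iff Tens_assoc)
    ultimately show ?thesis
      using H by (simp add: hom_iff theta_def flip: Comp_assoc_Arr)
  qed
  finally show ?thesis .
qed

text \<open>Both sides are
  \<open>f (h\<^sub>1) \<alpha> (h\<^sub>2, x) \<beta> (h\<^sub>3, y)\<close> in Sweedler notation,
  so an action on such a product only affects its first factor.\<close>

lemma star_theta:
  assumes "B \<in> Obj C" "P \<in> Obj C" "M \<in> Obj C" "N \<in> Obj C"
    "m \<in> hom C (B \<odot> B) B" "d \<in> hom C P (P \<odot> P)" "f \<in> hom C P B"
    "\<alpha> \<in> hom C (P \<odot> M) B" "\<beta> \<in> hom C (P \<odot> N) B"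
    and m: "m \<cdot> (m \<otimes> \<iota> B) = m \<cdot> (\<iota> B \<otimes> m)"
    and d: "(d \<otimes> \<iota> P) \<cdot> d = (\<iota> P \<otimes> d) \<cdot> d"
  shows "star m d (M \<odot> N) f (theta m d P M N \<alpha> \<beta>) = theta m d P M N (star m d M f \<alpha>) \<beta>"
proof -
  note H = assms(1-9)
  have dM: "(\<iota> P \<otimes> d \<otimes> \<iota> M \<otimes> \<iota> N) \<cdot> (d \<otimes> \<iota> M \<otimes> \<iota> N) = (d \<otimes> \<iota> P \<otimes> \<iota> M \<otimes> \<iota> N) \<cdot> (d \<otimes> \<iota> M \<otimes> \<iota> N)"
    using H d by (simp add: hom_iff interchange_nested_left)
  have "star m d (M \<odot> N) f (theta m d P M N \<alpha> \<beta>)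
      = (m \<cdot> (\<iota> B \<otimes> m)) \<cdot> ((f \<otimes> \<alpha> \<otimes> \<beta>) \<cdot> ((\<iota> P \<otimes> \<iota> P \<otimes> Braid C P M \<otimes> \<iota> N) \<cdot>
         ((\<iota> P \<otimes> d \<otimes> \<iota> M \<otimes> \<iota> N) \<cdot> (d \<otimes> \<iota> M \<otimes> \<iota> N))))"
    using H by (simp add: hom_iff star_def theta_def interchange_nested_right)
  also have "\<dots> = (m \<cdot> (m \<otimes> \<iota> B)) \<cdot> ((f \<otimes> \<alpha> \<otimes> \<beta>) \<cdot> ((\<iota> P \<otimes> \<iota> P \<otimes> Braid C P M \<otimes> \<iota> N) \<cdot>
         ((d \<otimes> \<iota> P \<otimes> \<iota> M \<otimes> \<iota> N) \<cdot> (d \<otimes> \<iota> M \<otimes> \<iota> N))))"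
    by (simp only: m dM)
  \<comment> \<open>The additional comultiplication and the braiding act on disjoint strands, so
    both orders equal \<open>d \<otimes> (Braid C P M \<otimes> \<iota> N)\<close>.\<close>
  also have "(\<iota> P \<otimes> \<iota> P \<otimes> Braid C P M \<otimes> \<iota> N) \<cdot> ((d \<otimes> \<iota> P \<otimes> \<iota> M \<otimes> \<iota> N) \<cdot> (d \<otimes> \<iota> M \<otimes> \<iota> N))
      = (d \<otimes> \<iota> M \<otimes> \<iota> P \<otimes> \<iota> N) \<cdot> ((\<iota> P \<otimes> Braid C P M \<otimes> \<iota> N) \<cdot> (d \<otimes> \<iota> M \<otimes> \<iota> N))"
  proof -
    have "(\<iota> P \<otimes> \<iota> P \<otimes> Braid C P M \<otimes> \<iota> N) \<cdot> (d \<otimes> \<iota> P \<otimes> \<iota> M \<otimes> \<iota> N)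
      = ((\<iota> P \<otimes> \<iota> P) \<otimes> (Braid C P M \<otimes> \<iota> N)) \<cdot> (d \<otimes> (\<iota> (P \<odot> M) \<otimes> \<iota> N))"
      using H by (simp add: hom_iff Tens_assoc Id_Tens)
    also have "\<dots> = d \<otimes> (Braid C P M \<otimes> \<iota> N)"
      using H by (simp add: hom_iff interchange Tens_Id)
    also have "\<dots> = (d \<otimes> \<iota> (M \<odot> P) \<otimes> \<iota> N) \<cdot> (\<iota> P \<otimes> Braid C P M \<otimes> \<iota> N)"
      using H by (simp add: hom_iff interchange Tens_Id Tens_assoc)
    finally show ?thesis 
      using H by (simp add: hom_iff Id_Tens Tens_assoc flip: Comp_assoc_Arr)
  qed
  also have "(m \<cdot> (m \<otimes> \<iota> B)) \<cdot> ((f \<otimes> \<alpha> \<otimes> \<beta>) \<cdot> \<dots>) = theta m d P M N (star m d M f \<alpha>) \<beta>"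
  proof -
    have "star m d M f \<alpha> \<otimes> \<beta> = (m \<otimes> \<iota> B) \<cdot> ((f \<otimes> \<alpha> \<otimes> \<beta>) \<cdot> (d \<otimes> \<iota> M \<otimes> (\<iota> P \<otimes> \<iota> N)))"
      using H by (simp add: hom_iff star_def interchange Tens_Id)
    then show ?thesis
      using H by (simp add: hom_iff theta_def Tens_assoc)
  qed
  finally show ?thesis .
qed

section \<open>The braiding with the unit object\<close>

text \<open>A hexagon identity at \<open>\<K>\<close>, \<open>\<K>\<close>, \<open>a\<close> makes
  this braiding idempotent, and an invertible idempotent is an identity.\<close>

lemma Braid_Unit_left [simp]:
  assumes "a \<in> Obj C"
  shows "Braid C \<K> a = \<iota> a"
proof -
  obtain d where "d \<in> hom C a a" and d: "d \<cdot> Braid C \<K> a = \<iota> a"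
    using Braid_iso [of \<K> a] assms by auto
  moreover have "Braid C \<K> a = Braid C \<K> a \<cdot> Braid C \<K> a"
    using Braid_Tens_left [of \<K> \<K> a] assms by simp
  then have "d \<cdot> Braid C \<K> a = (d \<cdot> Braid C \<K> a) \<cdot> Braid C \<K> a"
    using \<open>d \<in> _\<close> assms by (simp add: hom_iff)
  ultimately show ?thesis
    using assms by (simp only: d) (simp add: hom_iff)
qed

lemma Braid_Unit_right [simp]:
  assumes "a \<in> Obj C"
  shows "Braid C a \<K> = \<iota> a"
proof -
  obtain d where "d \<in> hom C a a" and d: "d \<cdot> Braid C a \<K> = \<iota> a"
    using Braid_iso [of a \<K>] assms by auto
  moreover have "Braid C a \<K> = Braid C a \<K> \<cdot> Braid C a \<K>"
    using Braid_Tens_right [of a \<K> \<K>] assms by simp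
  then have "d \<cdot> Braid C a \<K> = (d \<cdot> Braid C a \<K>) \<cdot> Braid C a \<K>"
    using \<open>d \<in> _\<close> assms by (simp add: hom_iff)
  ultimately show ?thesis
    using assms by (simp only: d) (simp add: hom_iff)
qed


section \<open>The tensor product of two coalgebras\<close>

text \<open>Supplies \<open>H \<odot> H\<close> as an acting coalgebra for the module law. For
  coassociativity, naturality and the hexagon identities bring both sides to the threefold
  comultiplications of \<open>D\<close> and \<open>E\<close> followed by one common shuffle.\<close>

lemma coalgebra_tensor_coalg:
  assumes "coalgebra C (D, e, d)" "coalgebra C (E, e', d')"
  shows "coalgebra C (tensor_coalg C (D, e, d) (E, e', d'))"
proof -
  have H: "D \<in> Obj C" "E \<in> Obj C" "e \<in> hom C D \<K>" "d \<in> hom C D (D \<odot> D)"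
    "e' \<in> hom C E \<K>" "d' \<in> hom C E (E \<odot> E)"
    and d: "(e \<otimes> \<iota> D) \<cdot> d = \<iota> D" "(\<iota> D \<otimes> e) \<cdot> d = \<iota> D" "(d \<otimes> \<iota> D) \<cdot> d = (\<iota> D \<otimes> d) \<cdot> d"
    and d': "(e' \<otimes> \<iota> E) \<cdot> d' = \<iota> E" "(\<iota> E \<otimes> e') \<cdot> d' = \<iota> E" "(d' \<otimes> \<iota> E) \<cdot> d' = (\<iota> E \<otimes> d') \<cdot> d'"
    using assms by auto
  define c where "c = Braid C D E"
  have c [simp]: "c \<in> Arr C" "Dom C c = D \<odot> E" "Cod C c = E \<odot> D"
    using H by (simp_all add: c_def)
  \<comment> \<open>On the other side of the naturality square stands the braiding with
    \<open>\<K>\<close>, which is trivial.\<close>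
  have e'c: "(e' \<otimes> \<iota> D) \<cdot> c = \<iota> D \<otimes> e'"
    using Braid_natural [of "\<iota> D" D D e' E \<K>] H Id_hom by (simp add: c_def hom_iff)
  have ec: "(\<iota> E \<otimes> e) \<cdot> c = e \<otimes> \<iota> E"
    using Braid_natural [of e D \<K> "\<iota> E" E E] H Id_hom by (simp add: c_def hom_iff)
  \<comment> \<open>Naturality produces the braiding of \<open>D\<close> with
    \<open>E \<odot> E\<close>, which a hexagon identity splits into two crossings.\<close>
  have d'c: "(d' \<otimes> \<iota> D) \<cdot> c = (\<iota> E \<otimes> c) \<cdot> ((c \<otimes> \<iota> E) \<cdot> (\<iota> D \<otimes> d'))"
    using Braid_natural [of "\<iota> D" D D d' E "E \<odot> E"] H Id_hom
    by (simp add: c_def hom_iff Braid_Tens_right)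
  have dc: "(\<iota> E \<otimes> d) \<cdot> c = (c \<otimes> \<iota> D) \<cdot> ((\<iota> D \<otimes> c) \<cdot> (d \<otimes> \<iota> E))"
    using Braid_natural [of d D "D \<odot> D" "\<iota> E" E E] H Id_hom
    by (simp add: c_def hom_iff Braid_Tens_left)
  let ?t = "(\<iota> D \<otimes> c \<otimes> \<iota> E) \<cdot> (d \<otimes> d')"
  have 1: "((e \<otimes> e') \<otimes> \<iota> (D \<odot> E)) \<cdot> ?t = \<iota> (D \<odot> E)"
  proof -
    have "((e \<otimes> e') \<otimes> \<iota> (D \<odot> E)) \<cdot> (\<iota> D \<otimes> c \<otimes> \<iota> E) = e \<otimes> (((e' \<otimes> \<iota> D) \<cdot> c) \<otimes> \<iota> E)"
    proof -
      have "(e \<otimes> e') \<otimes> \<iota> (D \<odot> E) = e \<otimes> ((e' \<otimes> \<iota> D) \<otimes> \<iota> E)"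
        "\<iota> D \<otimes> c \<otimes> \<iota> E = \<iota> D \<otimes> (c \<otimes> \<iota> E)"
        using H by (simp_all add: hom_iff Id_Tens Tens_assoc)
      then show ?thesis
        using H by (simp add: hom_iff interchange)
    qed
    also have "\<dots> = (e \<otimes> \<iota> D) \<otimes> (e' \<otimes> \<iota> E)"
      using H by (simp add: e'c hom_iff Tens_assoc)
    finally show ?thesis
      using H by (simp add: hom_iff interchange d d' Tens_Id flip: Comp_assoc_Arr)
  qed
  have 2: "(\<iota> (D \<odot> E) \<otimes> (e \<otimes> e')) \<cdot> ?t = \<iota> (D \<odot> E)"
  proof -
    have "(\<iota> (D \<odot> E) \<otimes> (e \<otimes> e')) \<cdot> (\<iota> D \<otimes> c \<otimes> \<iota> E) = \<iota> D \<otimes> (((\<iota> E \<otimes> e) \<cdot> c) \<otimes> e')"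
    proof -
      have "\<iota> (D \<odot> E) \<otimes> (e \<otimes> e') = \<iota> D \<otimes> ((\<iota> E \<otimes> e) \<otimes> e')"
        "\<iota> D \<otimes> c \<otimes> \<iota> E = \<iota> D \<otimes> (c \<otimes> \<iota> E)"
        using H by (simp_all add: hom_iff Id_Tens Tens_assoc)
      then show ?thesis
        using H by (simp add: hom_iff interchange)
    qed
    also have "\<dots> = (\<iota> D \<otimes> e) \<otimes> (\<iota> E \<otimes> e')"
      using H by (simp add: ec hom_iff Tens_assoc)
    finally show ?thesis
      using H by (simp add: hom_iff interchange d d' Tens_Id flip: Comp_assoc_Arr)
  qed
  have 3: "(?t \<otimes> \<iota> (D \<odot> E)) \<cdot> ?t = (\<iota> (D \<odot> E) \<otimes> ?t) \<cdot> ?t"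
  proof -
    \<comment> \<open>\<open>?m\<close> takes \<open>D \<odot> D \<odot> E \<odot> E\<close> to
      \<open>E \<odot> D \<odot> E \<odot> D\<close>; placed between an outer \<open>D\<close> and
      an outer \<open>E\<close> it sorts three copies of each into pairs.\<close>
    let ?m = "(c \<otimes> c) \<cdot> (\<iota> D \<otimes> c \<otimes> \<iota> E)"
    have c': "\<iota> D \<otimes> c \<otimes> \<iota> E = \<iota> D \<otimes> (c \<otimes> \<iota> E)"
      using H by (simp add: hom_iff Tens_assoc)
    have "(?t \<otimes> \<iota> (D \<odot> E)) \<cdot> ?t = ((\<iota> D \<otimes> c \<otimes> \<iota> E) \<otimes> \<iota> (D \<odot> E)) \<cdot>
        ((((d \<otimes> d') \<otimes> \<iota> (D \<odot> E)) \<cdot> (\<iota> D \<otimes> c \<otimes> \<iota> E)) \<cdot> (d \<otimes> d'))"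
    proof -
      have "?t \<otimes> \<iota> (D \<odot> E) = ((\<iota> D \<otimes> c \<otimes> \<iota> E) \<otimes> \<iota> (D \<odot> E)) \<cdot> ((d \<otimes> d') \<otimes> \<iota> (D \<odot> E))"
        using H by (simp add: hom_iff interchange)
      then show ?thesis
        using H by (simp add: hom_iff)
    qed
    also have "((d \<otimes> d') \<otimes> \<iota> (D \<odot> E)) \<cdot> (\<iota> D \<otimes> c \<otimes> \<iota> E)
        = d \<otimes> (((d' \<otimes> \<iota> D) \<cdot> c) \<otimes> \<iota> E)"
    proof -
      have "(d \<otimes> d') \<otimes> \<iota> (D \<odot> E) = d \<otimes> ((d' \<otimes> \<iota> D) \<otimes> \<iota> E)"
        using H by (simp add: hom_iff Id_Tens Tens_assoc)
      then show ?thesis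
        using H by (simp add: hom_iff c' interchange)
    qed
    also have "\<dots> = (\<iota> (D \<odot> D) \<otimes> (((\<iota> E \<otimes> c) \<cdot> (c \<otimes> \<iota> E)) \<otimes> \<iota> E)) \<cdot> ((d \<otimes> \<iota> D) \<otimes> (d' \<otimes> \<iota> E))"
    proof -
      have "(d \<otimes> \<iota> D) \<otimes> (d' \<otimes> \<iota> E) = d \<otimes> ((\<iota> D \<otimes> d') \<otimes> \<iota> E)"
        using H by (simp add: hom_iff Tens_assoc)
      then show ?thesis
        using H by (simp add: hom_iff d'c interchange)
    qed
    also have "((\<iota> D \<otimes> c \<otimes> \<iota> E) \<otimes> \<iota> (D \<odot> E)) \<cdot> (\<dots> \<cdot> (d \<otimes> d'))
        = (\<iota> D \<otimes> (?m \<otimes> \<iota> E)) \<cdot> (((d \<otimes> \<iota> D) \<cdot> d) \<otimes> ((d' \<otimes> \<iota> E) \<cdot> d'))"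
    proof -
      have "(\<iota> D \<otimes> c \<otimes> \<iota> E) \<otimes> \<iota> (D \<odot> E) = \<iota> D \<otimes> ((c \<otimes> \<iota> (E \<odot> D)) \<otimes> \<iota> E)"
        "\<iota> (D \<odot> D) \<otimes> (((\<iota> E \<otimes> c) \<cdot> (c \<otimes> \<iota> E)) \<otimes> \<iota> E)
          = \<iota> D \<otimes> (((\<iota> (D \<odot> E) \<otimes> c) \<cdot> (\<iota> D \<otimes> c \<otimes> \<iota> E)) \<otimes> \<iota> E)"
        using H by (simp_all add: hom_iff Id_Tens Tens_assoc interchange)
      \<comment> \<open>The last two crossings act on disjoint strands, so together they form
        \<open>c \<otimes> c\<close>.\<close>
      moreover have "(c \<otimes> \<iota> (E \<odot> D)) \<cdot> ((\<iota> (D \<odot> E) \<otimes> c) \<cdot> (\<iota> D \<otimes> c \<otimes> \<iota> E)) = ?m"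
        using H by (simp add: hom_iff interchange_assoc)
      ultimately have "((\<iota> D \<otimes> c \<otimes> \<iota> E) \<otimes> \<iota> (D \<odot> E)) \<cdot>
          (\<iota> (D \<odot> D) \<otimes> (((\<iota> E \<otimes> c) \<cdot> (c \<otimes> \<iota> E)) \<otimes> \<iota> E)) = \<iota> D \<otimes> (?m \<otimes> \<iota> E)"
        using H by (simp add: hom_iff interchange)
      then have "((\<iota> D \<otimes> c \<otimes> \<iota> E) \<otimes> \<iota> (D \<odot> E)) \<cdot>
          ((\<iota> (D \<odot> D) \<otimes> (((\<iota> E \<otimes> c) \<cdot> (c \<otimes> \<iota> E)) \<otimes> \<iota> E)) \<cdot> (((d \<otimes> \<iota> D) \<otimes> (d' \<otimes> \<iota> E)) \<cdot> (d \<otimes> d')))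
          = (\<iota> D \<otimes> (?m \<otimes> \<iota> E)) \<cdot> (((d \<otimes> \<iota> D) \<otimes> (d' \<otimes> \<iota> E)) \<cdot> (d \<otimes> d'))"
        using H by (simp add: hom_iff flip: Comp_assoc_Arr)
      then show ?thesis
        using H by (simp add: hom_iff interchange)
    qed
    \<comment> \<open>Coassociativity of both factors enters here; the remaining steps mirror the
      preceding ones, with \<open>dc\<close> in place of \<open>d'c\<close>.\<close>
    also have "\<dots> = (\<iota> D \<otimes> (?m \<otimes> \<iota> E)) \<cdot> (((\<iota> D \<otimes> d) \<cdot> d) \<otimes> ((\<iota> E \<otimes> d') \<cdot> d'))"
      by (simp only: d d')
    also have "\<dots> = (\<iota> (D \<odot> E) \<otimes> (\<iota> D \<otimes> c \<otimes> \<iota> E)) \<cdot>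
       (((\<iota> D \<otimes> (((c \<otimes> \<iota> D) \<cdot> (\<iota> D \<otimes> c)) \<otimes> \<iota> (E \<odot> E))) \<cdot> ((\<iota> D \<otimes> d) \<otimes> (\<iota> E \<otimes> d'))) \<cdot> (d \<otimes> d'))"
    proof -
      have "\<iota> (D \<odot> E) \<otimes> (\<iota> D \<otimes> c \<otimes> \<iota> E) = \<iota> D \<otimes> ((\<iota> (E \<odot> D) \<otimes> c) \<otimes> \<iota> E)"
        using H by (simp add: hom_iff Id_Tens Tens_assoc)
      moreover have "\<iota> D \<otimes> (((c \<otimes> \<iota> D) \<cdot> (\<iota> D \<otimes> c)) \<otimes> \<iota> (E \<odot> E))
          = \<iota> D \<otimes> (((c \<otimes> \<iota> (D \<odot> E)) \<cdot> (\<iota> D \<otimes> c \<otimes> \<iota> E)) \<otimes> \<iota> E)"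
      proof -
        have "((c \<otimes> \<iota> D) \<cdot> (\<iota> D \<otimes> c)) \<otimes> \<iota> (E \<odot> E) = (((c \<otimes> \<iota> D) \<cdot> (\<iota> D \<otimes> c)) \<otimes> \<iota> E) \<otimes> \<iota> E"
          using H by (simp add: hom_iff Id_Tens Tens_assoc)
        also have "((c \<otimes> \<iota> D) \<cdot> (\<iota> D \<otimes> c)) \<otimes> \<iota> E = (c \<otimes> \<iota> D \<otimes> \<iota> E) \<cdot> (\<iota> D \<otimes> c \<otimes> \<iota> E)"
          using H by (simp add: hom_iff interchange)
        finally show ?thesis
          using H by (simp add: hom_iff Id_Tens Tens_assoc)
      qed
      moreover have "(\<iota> (E \<odot> D) \<otimes> c) \<cdot> ((c \<otimes> \<iota> (D \<odot> E)) \<cdot> (\<iota> D \<otimes> c \<otimes> \<iota> E)) = ?m"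
        using H by (simp add: hom_iff interchange_assoc)
      ultimately have "(\<iota> (D \<odot> E) \<otimes> (\<iota> D \<otimes> c \<otimes> \<iota> E)) \<cdot>
          (\<iota> D \<otimes> (((c \<otimes> \<iota> D) \<cdot> (\<iota> D \<otimes> c)) \<otimes> \<iota> (E \<odot> E))) = \<iota> D \<otimes> (?m \<otimes> \<iota> E)"
        using H by (simp add: hom_iff interchange)
      then have "(\<iota> (D \<odot> E) \<otimes> (\<iota> D \<otimes> c \<otimes> \<iota> E)) \<cdot>
          ((\<iota> D \<otimes> (((c \<otimes> \<iota> D) \<cdot> (\<iota> D \<otimes> c)) \<otimes> \<iota> (E \<odot> E))) \<cdot> (((\<iota> D \<otimes> d) \<otimes> (\<iota> E \<otimes> d')) \<cdot> (d \<otimes> d')))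
          = (\<iota> D \<otimes> (?m \<otimes> \<iota> E)) \<cdot> (((\<iota> D \<otimes> d) \<otimes> (\<iota> E \<otimes> d')) \<cdot> (d \<otimes> d'))"
        using H by (simp add: hom_iff flip: Comp_assoc_Arr)
      then show ?thesis
        using H by (simp add: hom_iff interchange)
    qed
    also have "(\<iota> D \<otimes> (((c \<otimes> \<iota> D) \<cdot> (\<iota> D \<otimes> c)) \<otimes> \<iota> (E \<odot> E))) \<cdot> ((\<iota> D \<otimes> d) \<otimes> (\<iota> E \<otimes> d'))
        = \<iota> D \<otimes> (((\<iota> E \<otimes> d) \<cdot> c) \<otimes> d')"
    proof -
      have "(\<iota> D \<otimes> d) \<otimes> (\<iota> E \<otimes> d') = \<iota> D \<otimes> ((d \<otimes> \<iota> E) \<otimes> d')"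
        using H by (simp add: hom_iff Tens_assoc)
      then show ?thesis
        using H by (simp add: hom_iff dc interchange)
    qed
    also have "\<dots> = (\<iota> (D \<odot> E) \<otimes> (d \<otimes> d')) \<cdot> (\<iota> D \<otimes> c \<otimes> \<iota> E)"
    proof -
      have "\<iota> (D \<odot> E) \<otimes> (d \<otimes> d') = \<iota> D \<otimes> ((\<iota> E \<otimes> d) \<otimes> d')"
        using H by (simp add: hom_iff Id_Tens Tens_assoc)
      then show ?thesis
        using H by (simp add: hom_iff c' interchange)
    qed
    also have "(\<iota> (D \<odot> E) \<otimes> (\<iota> D \<otimes> c \<otimes> \<iota> E)) \<cdot> (\<dots> \<cdot> (d \<otimes> d')) = (\<iota> (D \<odot> E) \<otimes> ?t) \<cdot> ?t"
    proof -
      have "\<iota> (D \<odot> E) \<otimes> ?t = (\<iota> (D \<odot> E) \<otimes> (\<iota> D \<otimes> c \<otimes> \<iota> E)) \<cdot> (\<iota> (D \<odot> E) \<otimes> (d \<otimes> d'))"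
        using H by (simp add: hom_iff interchange)
      then show ?thesis
        using H by (simp add: hom_iff)
    qed
    finally show ?thesis .
  qed
  show ?thesis
    using H 1 2 3 by (simp add: c_def hom_iff)
qed

section \<open>Hopf algebras and cancellation by the antipode\<close>

text \<open>Besides unpacking the definition, this turns
  \<open>\<epsilon> X \<otimes> \<eta> X\<close> into \<open>\<eta> X \<cdot> \<epsilon> X\<close>,
  the form of the convolution unit in \<open>star_unit\<close>.\<close>

lemma hopf_algebraD:
  assumes "hopf_algebra C X"
  shows "ob X \<in> Obj C" "\<eta> X \<in> hom C \<K> (ob X)" "\<mu> X \<in> hom C (ob X \<odot> ob X) (ob X)"
    "\<epsilon> X \<in> hom C (ob X) \<K>" "\<delta> X \<in> hom C (ob X) (ob X \<odot> ob X)"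
    "antipode X \<in> hom C (ob X) (ob X)"
    "\<mu> X \<cdot> (\<eta> X \<otimes> \<iota> (ob X)) = \<iota> (ob X)" "\<mu> X \<cdot> (\<iota> (ob X) \<otimes> \<eta> X) = \<iota> (ob X)"
    "\<mu> X \<cdot> (\<mu> X \<otimes> \<iota> (ob X)) = \<mu> X \<cdot> (\<iota> (ob X) \<otimes> \<mu> X)"
    "(\<epsilon> X \<otimes> \<iota> (ob X)) \<cdot> \<delta> X = \<iota> (ob X)" "(\<iota> (ob X) \<otimes> \<epsilon> X) \<cdot> \<delta> X = \<iota> (ob X)"
    "(\<delta> X \<otimes> \<iota> (ob X)) \<cdot> \<delta> X = (\<iota> (ob X) \<otimes> \<delta> X) \<cdot> \<delta> X"
    "\<mu> X \<cdot> (antipode X \<otimes> \<iota> (ob X)) \<cdot> \<delta> X = \<eta> X \<cdot> \<epsilon> X"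
    "\<mu> X \<cdot> (\<iota> (ob X) \<otimes> antipode X) \<cdot> \<delta> X = \<eta> X \<cdot> \<epsilon> X"
    "\<epsilon> X \<cdot> \<eta> X = \<iota> \<K>" "\<delta> X \<cdot> \<eta> X = \<eta> X \<otimes> \<eta> X"
proof -
  have t: "\<epsilon> X \<otimes> \<eta> X = \<eta> X \<cdot> \<epsilon> X"
    if "ob X \<in> Obj C" "\<eta> X \<in> hom C \<K> (ob X)" "\<epsilon> X \<in> hom C (ob X) \<K>"
    using interchange [of "\<epsilon> X" "\<iota> \<K>" "\<iota> \<K>" "\<eta> X"] that by (simp add: hom_iff)
  note a = assms [unfolded hopf_algebra_def alg_def coalg_def unit_coalg_def algebra.simps
      coalgebra.simps coalgebra_morphism.simps tensor_coalg.simps]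
  show "ob X \<in> Obj C" "\<eta> X \<in> hom C \<K> (ob X)" "\<mu> X \<in> hom C (ob X \<odot> ob X) (ob X)"
    "\<epsilon> X \<in> hom C (ob X) \<K>" "\<delta> X \<in> hom C (ob X) (ob X \<odot> ob X)"
    "antipode X \<in> hom C (ob X) (ob X)"
    "\<mu> X \<cdot> (\<eta> X \<otimes> \<iota> (ob X)) = \<iota> (ob X)" "\<mu> X \<cdot> (\<iota> (ob X) \<otimes> \<eta> X) = \<iota> (ob X)"
    "\<mu> X \<cdot> (\<mu> X \<otimes> \<iota> (ob X)) = \<mu> X \<cdot> (\<iota> (ob X) \<otimes> \<mu> X)"
    "(\<epsilon> X \<otimes> \<iota> (ob X)) \<cdot> \<delta> X = \<iota> (ob X)" "(\<iota> (ob X) \<otimes> \<epsilon> X) \<cdot> \<delta> X = \<iota> (ob X)"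
    "(\<delta> X \<otimes> \<iota> (ob X)) \<cdot> \<delta> X = (\<iota> (ob X) \<otimes> \<delta> X) \<cdot> \<delta> X"
    "\<mu> X \<cdot> (antipode X \<otimes> \<iota> (ob X)) \<cdot> \<delta> X = \<eta> X \<cdot> \<epsilon> X"
    "\<mu> X \<cdot> (\<iota> (ob X) \<otimes> antipode X) \<cdot> \<delta> X = \<eta> X \<cdot> \<epsilon> X"
    "\<epsilon> X \<cdot> \<eta> X = \<iota> \<K>" "\<delta> X \<cdot> \<eta> X = \<eta> X \<otimes> \<eta> X"
    using a by (auto simp: t hom_iff)
qed

text \<open>A coalgebra morphism \<open>f\<close> passes through the comultiplication, so the
  convolution products of \<open>f\<close> and \<open>antipode B \<cdot> f\<close> are the antipode
  equations precomposed with \<open>f\<close>, hence both equal the unit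
  \<open>\<eta> B \<cdot> e\<close>.\<close>

lemma star_antipode:
  assumes B: "hopf_algebra C B" and P: "coalgebra C (P, e, d)"
    and f: "coalgebra_morphism C (P, e, d) (coalg B) f"
    and M: "M \<in> Obj C" and \<Psi>: "\<Psi> \<in> hom C (P \<odot> M) (ob B)"
  shows "star (\<mu> B) d M (antipode B \<cdot> f) (star (\<mu> B) d M f \<Psi>) = \<Psi>"
    and "star (\<mu> B) d M f (star (\<mu> B) d M (antipode B \<cdot> f) \<Psi>) = \<Psi>"
proof -
  note b = hopf_algebraD [OF B]
  have H: "P \<in> Obj C" "e \<in> hom C P \<K>" "d \<in> hom C P (P \<odot> P)" "f \<in> hom C P (ob B)"
    and de: "(e \<otimes> \<iota> P) \<cdot> d = \<iota> P" "(d \<otimes> \<iota> P) \<cdot> d = (\<iota> P \<otimes> d) \<cdot> d"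
    and f': "\<epsilon> B \<cdot> f = e" "(f \<otimes> f) \<cdot> d = \<delta> B \<cdot> f"
    using P f by (auto simp: coalg_def)
  have l: "antipode B \<cdot> f \<in> hom C P (ob B)"
    using b H by (simp add: hom_iff)
  have *: "\<mu> B \<cdot> ((antipode B \<cdot> f) \<otimes> f) \<cdot> d = \<eta> B \<cdot> e" "\<mu> B \<cdot> (f \<otimes> (antipode B \<cdot> f)) \<cdot> d = \<eta> B \<cdot> e"
  proof -
    have "(antipode B \<cdot> f) \<otimes> f = (antipode B \<otimes> \<iota> (ob B)) \<cdot> (f \<otimes> f)"
      "f \<otimes> (antipode B \<cdot> f) = (\<iota> (ob B) \<otimes> antipode B) \<cdot> (f \<otimes> f)"
      using b(1-6) H by (simp_all add: hom_iff interchange)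
    then have "\<mu> B \<cdot> ((antipode B \<cdot> f) \<otimes> f) \<cdot> d = (\<mu> B \<cdot> (antipode B \<otimes> \<iota> (ob B)) \<cdot> \<delta> B) \<cdot> f"
      "\<mu> B \<cdot> (f \<otimes> (antipode B \<cdot> f)) \<cdot> d = (\<mu> B \<cdot> (\<iota> (ob B) \<otimes> antipode B) \<cdot> \<delta> B) \<cdot> f"
      using b(1-6) H f'(2) by (simp_all add: hom_iff)
    then show "\<mu> B \<cdot> ((antipode B \<cdot> f) \<otimes> f) \<cdot> d = \<eta> B \<cdot> e"
        "\<mu> B \<cdot> (f \<otimes> (antipode B \<cdot> f)) \<cdot> d = \<eta> B \<cdot> e"
      using b(1-6) H unfolding b(13,14) by (simp_all add: hom_iff f'(1))
  qed
  show "star (\<mu> B) d M (antipode B \<cdot> f) (star (\<mu> B) d M f \<Psi>) = \<Psi>"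
    using star_assoc [OF b(1) H(1) M b(3) H(3) l H(4) \<Psi> b(9) de(2)]
      star_unit [OF b(1) H(1) M b(3) H(3) b(2) H(2) \<Psi> b(7) de(1)] by (simp only: *)
  show "star (\<mu> B) d M f (star (\<mu> B) d M (antipode B \<cdot> f) \<Psi>) = \<Psi>"
    using star_assoc [OF b(1) H(1) M b(3) H(3) H(4) l \<Psi> b(9) de(2)]
      star_unit [OF b(1) H(1) M b(3) H(3) b(2) H(2) \<Psi> b(7) de(1)] by (simp only: *)
qed

text \<open>Both arrows are right convolution inverses of \<open>f\<close>. For
  \<open>f \<cdot> antipode X\<close> this follows from the antipode equation of \<open>X\<close>;
  letting \<open>antipode Y \<cdot> f\<close> act then cancels \<open>f\<close>.\<close>

lemma hopf_morphism_antipode: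
  assumes X: "hopf_algebra C X" and Y: "hopf_algebra C Y" and f: "hopf_morphism C X Y f"
  shows "f \<cdot> antipode X = antipode Y \<cdot> f"
proof -
  note x = hopf_algebraD [OF X] and y = hopf_algebraD [OF Y]
  have f': "f \<in> hom C (ob X) (ob Y)" "f \<cdot> \<eta> X = \<eta> Y" "f \<cdot> \<mu> X = \<mu> Y \<cdot> (f \<otimes> f)"
    "coalgebra_morphism C (ob X, \<epsilon> X, \<delta> X) (coalg Y) f"
    and cX: "coalgebra C (ob X, \<epsilon> X, \<delta> X)"
    using f X by (auto simp: hopf_morphism_def hopf_algebra_def alg_def coalg_def)
  \<comment> \<open>By strictness \<open>ob X \<odot> \<K>\<close> is \<open>ob X\<close>; this form
    fits the action with \<open>M = \<K>\<close>.\<close>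
  have fa: "f \<cdot> antipode X \<in> hom C (ob X \<odot> \<K>) (ob Y)"
    using x y f' by (simp add: hom_iff)
  have "star (\<mu> Y) (\<delta> X) \<K> f (f \<cdot> antipode X) = \<mu> Y \<cdot> (f \<otimes> f) \<cdot> ((\<iota> (ob X) \<otimes> antipode X) \<cdot> \<delta> X)"
    using x(1-6) y(1-6) f'(1) by (simp add: star_def hom_iff interchange interchange_assoc)
  also have "\<dots> = f \<cdot> (\<mu> X \<cdot> (\<iota> (ob X) \<otimes> antipode X) \<cdot> \<delta> X)"
    using x(1-6) y(1-6) f'(1) unfolding f'(3) [symmetric] by (simp add: hom_iff)
  also have "\<dots> = \<eta> Y \<cdot> \<epsilon> X"
    using x(1-6) f'(1) unfolding x(14) f'(2) [symmetric] by (simp add: hom_iff)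
  finally have *: "star (\<mu> Y) (\<delta> X) \<K> f (f \<cdot> antipode X) = \<eta> Y \<cdot> \<epsilon> X" .
  have "f \<cdot> antipode X = star (\<mu> Y) (\<delta> X) \<K> (antipode Y \<cdot> f) (\<eta> Y \<cdot> \<epsilon> X)"
    using star_antipode(1) [OF Y cX f'(4) Unit_Obj fa] by (simp add: *)
  \<comment> \<open>The right unit law of convolution, from the right unit law of
    \<open>\<mu> Y\<close> and the right counit law of \<open>\<delta> X\<close>;
    \<open>star_unit\<close> is the left one.\<close>
  also have "\<dots> = (\<mu> Y \<cdot> (\<iota> (ob Y) \<otimes> \<eta> Y)) \<cdot> ((antipode Y \<cdot> f) \<cdot> ((\<iota> (ob X) \<otimes> \<epsilon> X) \<cdot> \<delta> X))"
  proof -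
    have "(antipode Y \<cdot> f) \<otimes> (\<eta> Y \<cdot> \<epsilon> X) = ((\<iota> (ob Y) \<otimes> \<eta> Y) \<cdot> ((antipode Y \<cdot> f) \<otimes> \<iota> \<K>)) \<cdot> (\<iota> (ob X) \<otimes> \<epsilon> X)"
      using x(1-6) y(1-6) f'(1) by (simp add: hom_iff interchange del: Tens_Unit)
    then show ?thesis
      using x(1-6) y(1-6) f'(1) by (simp add: star_def hom_iff)
  qed
  also have "\<dots> = antipode Y \<cdot> f"
    using x(1-6) y(1-6) f'(1) unfolding x(11) y(8) by (simp add: hom_iff)
  finally show ?thesis .
qed


section \<open>Coalgebra morphisms\<close>

lemma coalgebra_morphism_comp:
  assumes "coalgebra_morphism C (P, e, d) (Q, e', d') f" "coalgebra_morphism C (Q, e', d') (R, e'', d'') g"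
    and "d \<in> hom C P (P \<odot> P)" "d' \<in> hom C Q (Q \<odot> Q)" "d'' \<in> hom C R (R \<odot> R)" "e'' \<in> hom C R \<K>"
  shows "coalgebra_morphism C (P, e, d) (R, e'', d'') (g \<cdot> f)"
proof -
  have H: "f \<in> hom C P Q" "g \<in> hom C Q R" and *: "e' \<cdot> f = e" "d' \<cdot> f = (f \<otimes> f) \<cdot> d"
      "e'' \<cdot> g = e'" "d'' \<cdot> g = (g \<otimes> g) \<cdot> d'"
    using assms by auto
  have "e'' \<cdot> (g \<cdot> f) = (e'' \<cdot> g) \<cdot> f" "d'' \<cdot> (g \<cdot> f) = (d'' \<cdot> g) \<cdot> f"
    using H assms(3-) by (simp_all add: hom_iff)
  then have "e'' \<cdot> (g \<cdot> f) = e" "d'' \<cdot> (g \<cdot> f) = ((g \<cdot> f) \<otimes> (g \<cdot> f)) \<cdot> d"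
    using H assms(3-) unfolding * by (simp_all add: hom_iff * interchange_assoc)
  then show ?thesis
    using H by (simp add: hom_iff)
qed

text \<open>The unit of \<open>B\<close> is grouplike, and by naturality its crossing with
  \<open>H\<close> becomes the trivial braiding with \<open>\<K>\<close>. This is the first half of
  showing that \<open>u_map\<close> is a coalgebra morphism.\<close>

lemma coalgebra_morphism_tensor_unit:
  assumes "hopf_algebra C H" "hopf_algebra C B"
  shows "coalgebra_morphism C (coalg H) (tensor_coalg C (coalg H) (coalg B)) (\<iota> (ob H) \<otimes> \<eta> B)"
proof -
  note h = hopf_algebraD [OF assms(1)] and b = hopf_algebraD [OF assms(2)]
  let ?H = "ob H" and ?B = "ob B"
  have nat: "Braid C ?H ?B \<cdot> (\<iota> ?H \<otimes> \<eta> B) = \<eta> B \<otimes> \<iota> ?H"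
    using Braid_natural [of "\<iota> ?H" ?H ?H "\<eta> B" \<K> ?B] h(1) b(1,2) Id_hom by (simp add: hom_iff)
  have "((\<iota> ?H \<otimes> Braid C ?H ?B \<otimes> \<iota> ?B) \<cdot> (\<delta> H \<otimes> \<delta> B)) \<cdot> (\<iota> ?H \<otimes> \<eta> B)
      = (\<iota> ?H \<otimes> (Braid C ?H ?B \<otimes> \<iota> ?B)) \<cdot> (\<delta> H \<otimes> (\<delta> B \<cdot> \<eta> B))"
    using h(1-6) b(1-6) by (simp add: hom_iff interchange Tens_assoc)
  also have "\<delta> H \<otimes> (\<delta> B \<cdot> \<eta> B) = (\<iota> ?H \<otimes> ((\<iota> ?H \<otimes> \<eta> B) \<otimes> \<eta> B)) \<cdot> \<delta> H"
  proof -
    have "\<delta> H \<otimes> (\<eta> B \<otimes> \<eta> B) = (\<iota> (?H \<odot> ?H) \<otimes> (\<eta> B \<otimes> \<eta> B)) \<cdot> (\<delta> H \<otimes> \<iota> \<K>)"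
      using h(1-6) b(1-6) by (simp add: hom_iff interchange del: Tens_Unit)
    then show ?thesis
      using h(1-6) b(1-6) unfolding b(16) by (simp add: hom_iff Id_Tens Tens_assoc)
  qed
  also have "(\<iota> ?H \<otimes> (Braid C ?H ?B \<otimes> \<iota> ?B)) \<cdot> \<dots> = (\<iota> ?H \<otimes> ((\<eta> B \<otimes> \<iota> ?H) \<otimes> \<eta> B)) \<cdot> \<delta> H"
    using h(1-6) b(1-6) by (simp add: hom_iff interchange interchange_assoc nat)
  also have "\<dots> = ((\<iota> ?H \<otimes> \<eta> B) \<otimes> (\<iota> ?H \<otimes> \<eta> B)) \<cdot> \<delta> H"
    using h(1-6) b(1-6) by (simp add: hom_iff Tens_assoc)
  finally show ?thesis
    using h(1-6) b(1-6,15) by (simp add: coalg_def hom_iff interchange)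
qed

lemma hopf_algebra_coalgebra: "hopf_algebra C X \<Longrightarrow> coalgebra C (ob X, \<epsilon> X, \<delta> X)"
  by (simp add: hopf_algebra_def coalg_def)

lemma hopf_algebra_unit_morphism:
  "hopf_algebra C X \<Longrightarrow> coalgebra_morphism C (\<K>, \<iota> \<K>, \<iota> \<K>) (coalg X) (\<eta> X)"
  by (simp add: hopf_algebra_def unit_coalg_def)

lemma coalgebra_unit: "coalgebra C (\<K>, \<iota> \<K>, \<iota> \<K>)"
  by (simp add: hom_iff)

end

section \<open>The 1-cocycle of a bracoid whose action is a coalgebra morphism\<close>

locale coalgebraic_bracoid = plain_braided_category C
  for C :: "('o, 'a) braided_category" (structure) +
  fixes H B :: "('o, 'a) hopf" and \<phi> :: 'a
  assumes bracoid: "hopf_bracoid C (H, B, \<phi>)"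
    and \<phi>_coalgebra_morphism:
      "coalgebra_morphism C (tensor_coalg C (coalg H) (coalg B)) (coalg B) \<phi>"
begin

abbreviation "u \<equiv> u_map C H B \<phi>"
abbreviation "\<Phi> \<equiv> Phi_map C H B \<phi>"
abbreviation "st \<equiv> star (\<mu> B) (\<delta> H)"
abbreviation "th \<equiv> theta (\<mu> B) (\<delta> H) (ob H)"

lemma hopf: "hopf_algebra C H" "hopf_algebra C B"
  using bracoid by auto

lemmas h = hopf_algebraD [OF hopf(1)]
lemmas b = hopf_algebraD [OF hopf(2)]

lemma \<phi>_hom: "\<phi> \<in> hom C (ob H \<odot> ob B) (ob B)"
  using bracoid by (auto simp: left_module_def)

lemma \<phi>_unit: "\<phi> \<cdot> (\<eta> H \<otimes> \<iota> (ob B)) = \<iota> (ob B)"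
  and \<phi>_mult: "\<phi> \<cdot> (\<iota> (ob H) \<otimes> \<phi>) = \<phi> \<cdot> (\<mu> H \<otimes> \<iota> (ob B))"
  using bracoid by (auto simp: left_module_def)

lemma u_hom: "u \<in> hom C (ob H) (ob B)"
  using \<phi>_hom h(1-6) b(1-6) by (simp add: u_map_def hom_iff)

lemmas hb = h(1-6) b(1-6) \<phi>_hom u_hom

lemma \<Phi>_star: "\<Phi> = st (ob B) (antipode B \<cdot> u) \<phi>"
  using hb by (simp add: Phi_map_def star_def hom_iff)

lemma \<Phi>_hom: "\<Phi> \<in> hom C (ob H \<odot> ob B) (ob B)"
  using hb by (simp add: \<Phi>_star star_def hom_iff)

lemma antipode_u_hom: "antipode B \<cdot> u \<in> hom C (ob H) (ob B)"
  using hb by (simp add: hom_iff)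

text \<open>\<open>u\<close> is a composite of the coalgebra morphisms
  \<open>\<iota> (ob H) \<otimes> \<eta> B\<close> and \<open>\<phi>\<close>. Here the restriction
  to \<open>HBrcd_bar\<close> enters, and cancellation of \<open>u\<close> relies on it.\<close>

lemma u_coalgebra_morphism: "coalgebra_morphism C (ob H, \<epsilon> H, \<delta> H) (coalg B) u"
  unfolding coalg_def u_map_def
proof (rule coalgebra_morphism_comp)
  show "coalgebra_morphism C (ob H, \<epsilon> H, \<delta> H)
      (ob H \<odot> ob B, \<epsilon> H \<otimes> \<epsilon> B, (\<iota> (ob H) \<otimes> Braid C (ob H) (ob B) \<otimes> \<iota> (ob B)) \<cdot> (\<delta> H \<otimes> \<delta> B))
      (\<iota> (ob H) \<otimes> \<eta> B)"
    using coalgebra_morphism_tensor_unit [OF hopf] by (simp only: coalg_def tensor_coalg.simps)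
  show "coalgebra_morphism C
      (ob H \<odot> ob B, \<epsilon> H \<otimes> \<epsilon> B, (\<iota> (ob H) \<otimes> Braid C (ob H) (ob B) \<otimes> \<iota> (ob B)) \<cdot> (\<delta> H \<otimes> \<delta> B))
      (ob B, \<epsilon> B, \<delta> B) \<phi>"
    using \<phi>_coalgebra_morphism by (simp only: coalg_def tensor_coalg.simps)
qed (use hb in \<open>auto simp: hom_iff\<close>)

lemma star_u_\<Phi>: "st (ob B) u \<Phi> = \<phi>"
  unfolding \<Phi>_star
  by (rule star_antipode(2) [OF hopf(2) hopf_algebra_coalgebra [OF hopf(1)] u_coalgebra_morphism b(1) \<phi>_hom])

lemma compatibility: "\<phi> \<cdot> (\<iota> (ob H) \<otimes> \<mu> B) = th (ob B) (ob B) \<phi> \<Phi>"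
  using bracoid hb \<Phi>_hom by (simp add: theta_def hom_iff)

text \<open>Acting with \<open>antipode B \<cdot> u\<close> on the bracoid equation changes only the
  first factor of its right-hand side, by \<open>star_theta\<close>, and there turns
  \<open>\<phi>\<close> into \<open>\<Phi>\<close>.\<close>

lemma \<Phi>_module_algebra_mult: "\<Phi> \<cdot> (\<iota> (ob H) \<otimes> \<mu> B) = th (ob B) (ob B) \<Phi> \<Phi>"
proof -
  have "\<Phi> \<cdot> (\<iota> (ob H) \<otimes> \<mu> B)
      = st (ob B \<odot> ob B) (antipode B \<cdot> u \<cdot> \<iota> (ob H)) (\<phi> \<cdot> (\<iota> (ob H) \<otimes> \<mu> B))"
    unfolding \<Phi>_star using hb by (subst star_comp) (auto simp: hom_iff Tens_Id)
  also have "\<dots> = st (ob B \<odot> ob B) (antipode B \<cdot> u) (th (ob B) (ob B) \<phi> \<Phi>)"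
    using hb by (simp add: compatibility hom_iff)
  also have "\<dots> = th (ob B) (ob B) \<Phi> \<Phi>"
    by (subst star_theta [OF b(1) h(1) b(1) b(1) b(3) h(5) antipode_u_hom \<phi>_hom \<Phi>_hom b(9) h(12)])
      (simp only: \<Phi>_star)
  finally show ?thesis .
qed

text \<open>The unit of \<open>H\<close> is grouplike and \<open>u\<close> maps it to the unit of
  \<open>B\<close>. What remains is the action of \<open>antipode B \<cdot> \<eta> B\<close> over
  the coalgebra \<open>\<K>\<close>, which is trivial.\<close>

lemma \<Phi>_unit: "\<Phi> \<cdot> (\<eta> H \<otimes> \<iota> (ob B)) = \<iota> (ob B)"
proof -
  note e = hopf_algebra_unit_morphism [OF hopf(2)]
  have u\<eta>: "u \<cdot> \<eta> H = \<eta> B"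
  proof -
    have "u \<cdot> \<eta> H = (\<phi> \<cdot> (\<eta> H \<otimes> \<iota> (ob B))) \<cdot> (\<iota> \<K> \<otimes> \<eta> B)"
      using interchange [of "\<iota> \<K>" "\<eta> B" "\<eta> H" "\<iota> (ob B)"] interchange [of "\<eta> H" "\<iota> \<K>" "\<iota> (ob H)" "\<eta> B"] hb
      by (simp add: u_map_def hom_iff)
    then show ?thesis
      using hb by (simp add: \<phi>_unit hom_iff)
  qed
  have "\<Phi> \<cdot> (\<eta> H \<otimes> \<iota> (ob B)) = star (\<mu> B) (\<iota> \<K>) (ob B) ((antipode B \<cdot> u) \<cdot> \<eta> H) (\<phi> \<cdot> (\<eta> H \<otimes> \<iota> (ob B)))"
    unfolding \<Phi>_star using hb h(16) by (subst star_comp [where Q = \<K>]) (auto simp: hom_iff)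
  also have "\<dots> = star (\<mu> B) (\<iota> \<K>) (ob B) (antipode B \<cdot> \<eta> B) (\<iota> (ob B))"
    using hb by (simp add: hom_iff \<phi>_unit u\<eta>)
  \<comment> \<open>By the left unit law the action of \<open>\<eta> B\<close> is trivial; it is
    inserted so that \<open>star_antipode\<close> can cancel it.\<close>
  also have "\<dots> = star (\<mu> B) (\<iota> \<K>) (ob B) (antipode B \<cdot> \<eta> B)
      (star (\<mu> B) (\<iota> \<K>) (ob B) (\<eta> B) (\<iota> (ob B)))"
    using hb b(7) by (simp add: star_def hom_iff)
  also have "\<dots> = \<iota> (ob B)"
    using hb by (intro star_antipode(1) [OF hopf(2) coalgebra_unit e]) (auto simp: hom_iff)
  finally show ?thesis .
qed

text \<open>Evaluating \<open>\<phi>\<close> at the unit of \<open>B\<close> gives \<open>u\<close>,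
  so the left-hand side is the convolution product of \<open>antipode B \<cdot> u\<close> and
  \<open>u\<close>, which is the convolution unit.\<close>

lemma \<Phi>_module_algebra_unit: "\<Phi> \<cdot> (\<iota> (ob H) \<otimes> \<eta> B) = \<epsilon> H \<otimes> \<eta> B"
proof -
  have t: "\<epsilon> H \<otimes> \<eta> B = \<eta> B \<cdot> \<epsilon> H"
    using interchange [of "\<epsilon> H" "\<iota> \<K>" "\<iota> \<K>" "\<eta> B"] hb by (simp add: hom_iff)
  \<comment> \<open>The right unit law of convolution; it presents \<open>u\<close> as the action of
    \<open>u\<close> on the unit, ready for cancellation.\<close>
  have *: "u = st \<K> u (\<eta> B \<cdot> \<epsilon> H)"
  proof -
    have "u \<otimes> (\<eta> B \<cdot> \<epsilon> H) = ((\<iota> (ob B) \<otimes> \<eta> B) \<cdot> (u \<otimes> \<iota> \<K>)) \<cdot> (\<iota> (ob H) \<otimes> \<epsilon> H)"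
      using hb by (simp add: hom_iff interchange del: Tens_Unit)
    then have "st \<K> u (\<eta> B \<cdot> \<epsilon> H) = (\<mu> B \<cdot> (\<iota> (ob B) \<otimes> \<eta> B)) \<cdot> (u \<cdot> ((\<iota> (ob H) \<otimes> \<epsilon> H) \<cdot> \<delta> H))"
      using hb by (simp add: star_def hom_iff)
    then show ?thesis
      using hb unfolding h(11) b(8) by (simp add: hom_iff)
  qed
  have "\<Phi> \<cdot> (\<iota> (ob H) \<otimes> \<eta> B) = st \<K> (antipode B \<cdot> u \<cdot> \<iota> (ob H)) (\<phi> \<cdot> (\<iota> (ob H) \<otimes> \<eta> B))"
    unfolding \<Phi>_star using hb by (subst star_comp) (auto simp: hom_iff Tens_Id)
  also have "\<dots> = st \<K> (antipode B \<cdot> u) u"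
    using hb by (simp add: u_map_def hom_iff)
  also have "\<dots> = st \<K> (antipode B \<cdot> u) (st \<K> u (\<eta> B \<cdot> \<epsilon> H))"
    using * by simp
  also have "\<dots> = \<eta> B \<cdot> \<epsilon> H"
    using hb by (intro star_antipode(1) [OF hopf(2) hopf_algebra_coalgebra [OF hopf(1)] u_coalgebra_morphism])
      (auto simp: hom_iff)
  finally show ?thesis
    by (simp only: t)
qed

text \<open>Evaluating the module law of \<open>\<phi>\<close> at the unit of \<open>B\<close> gives
  \<open>u (h k) = \<phi> (h, u k)\<close>, and \<open>\<phi>\<close> is the action of
  \<open>u\<close> on \<open>\<Phi>\<close>.\<close>

lemma u_mult: "u \<cdot> \<mu> H = st (ob H) u (\<Phi> \<cdot> (\<iota> (ob H) \<otimes> u))"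
proof -
  have "u \<cdot> \<mu> H = (\<phi> \<cdot> (\<mu> H \<otimes> \<iota> (ob B))) \<cdot> (\<iota> (ob H) \<otimes> \<iota> (ob H) \<otimes> \<eta> B)"
  proof -
    have "\<mu> H = \<mu> H \<otimes> \<iota> \<K>"
      using hb by (simp add: hom_iff)
    then have "(\<iota> (ob H) \<otimes> \<eta> B) \<cdot> \<mu> H = (\<mu> H \<otimes> \<iota> (ob B)) \<cdot> (\<iota> (ob H \<odot> ob H) \<otimes> \<eta> B)"
      using hb interchange [of "\<mu> H" "\<iota> \<K>" "\<iota> (ob H)" "\<eta> B"] by (simp add: hom_iff interchange)
    then show ?thesis
      using hb by (simp add: u_map_def hom_iff Tens_Id)
  qed
  also have "\<dots> = \<phi> \<cdot> (\<iota> (ob H) \<otimes> u)"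
    unfolding \<phi>_mult [symmetric] using hb by (simp add: u_map_def hom_iff interchange Tens_assoc)
  also have "\<dots> = st (ob B) u \<Phi> \<cdot> (\<iota> (ob H) \<otimes> u)"
    by (simp only: star_u_\<Phi>)
  also have "\<dots> = st (ob H) (u \<cdot> \<iota> (ob H)) (\<Phi> \<cdot> (\<iota> (ob H) \<otimes> u))"
    using hb \<Phi>_hom by (intro star_comp) (auto simp: hom_iff Tens_Id)
  finally show ?thesis
    using hb by (simp add: hom_iff)
qed

lemma cocycle: "\<mu> B \<cdot> (u \<otimes> \<Phi>) \<cdot> (\<delta> H \<otimes> u) = u \<cdot> \<mu> H"
proof -
  have "(u \<otimes> \<Phi>) \<cdot> (\<delta> H \<otimes> u) = (u \<otimes> (\<Phi> \<cdot> (\<iota> (ob H) \<otimes> u))) \<cdot> (\<delta> H \<otimes> \<iota> (ob H))"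
  proof -
    have "\<delta> H \<otimes> u = (\<iota> (ob H) \<otimes> (\<iota> (ob H) \<otimes> u)) \<cdot> (\<delta> H \<otimes> \<iota> (ob H))"
      using hb by (simp add: hom_iff interchange Tens_assoc_sym Tens_Id)
    then show ?thesis
      using hb \<Phi>_hom by (simp add: hom_iff interchange interchange_assoc)
  qed
  then show ?thesis
    using hb \<Phi>_hom by (simp add: u_mult star_def hom_iff)
qed

lemma \<Phi>_mult: "\<Phi> \<cdot> (\<iota> (ob H) \<otimes> \<Phi>) = \<Phi> \<cdot> (\<mu> H \<otimes> \<iota> (ob B))"
proof -
  let ?H = "ob H" and ?B = "ob B"
  \<comment> \<open>By strictness also an arrow out of \<open>(?H \<odot> ?H) \<odot> ?B\<close>, on
    which arrows out of the coalgebra \<open>?H \<odot> ?H\<close> act.\<close>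
  let ?\<Psi> = "\<Phi> \<cdot> (\<iota> ?H \<otimes> \<Phi>)"
  let ?d = "(\<iota> ?H \<otimes> Braid C ?H ?H \<otimes> \<iota> ?H) \<cdot> (\<delta> H \<otimes> \<delta> H)"
  have c: "coalgebra C (?H \<odot> ?H, \<epsilon> H \<otimes> \<epsilon> H, ?d)"
    using coalgebra_tensor_coalg [OF hopf_algebra_coalgebra [OF hopf(1)] hopf_algebra_coalgebra [OF hopf(1)]]
    by (simp only: tensor_coalg.simps)
  have \<mu>: "coalgebra_morphism C (?H \<odot> ?H, \<epsilon> H \<otimes> \<epsilon> H, ?d) (ob H, \<epsilon> H, \<delta> H) (\<mu> H)"
    using hopf(1) by (simp only: hopf_algebra_def coalg_def tensor_coalg.simps)
  have d: "?d \<in> hom C (?H \<odot> ?H) (?H \<odot> ?H \<odot> (?H \<odot> ?H))"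
    using hb by (simp add: hom_iff)
  have u\<mu>: "coalgebra_morphism C (?H \<odot> ?H, \<epsilon> H \<otimes> \<epsilon> H, ?d) (coalg B) (u \<cdot> \<mu> H)"
    unfolding coalg_def
    using \<mu> u_coalgebra_morphism [unfolded coalg_def] d h(5) b(5) b(4) by (rule coalgebra_morphism_comp)
  have \<Psi>: "?\<Psi> \<in> hom C ((?H \<odot> ?H) \<odot> ?B) ?B"
    using hb \<Phi>_hom by (simp add: hom_iff)
  \<comment> \<open>In Sweedler notation this is
    \<open>u (h\<^sub>1 k\<^sub>1) ?\<Psi> (h\<^sub>2, k\<^sub>2, b)\<close>. Comultiplying
    \<open>k\<close> first leaves a \<open>theta\<close> with passive arguments
    \<open>k\<^sub>1\<close> and \<open>(k\<^sub>2, b)\<close>.\<close>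
  have "star (\<mu> B) ?d ?B (u \<cdot> \<mu> H) ?\<Psi> = th ?H (?H \<odot> ?B) (u \<cdot> \<mu> H) ?\<Psi> \<cdot> (\<iota> ?H \<otimes> (\<delta> H \<otimes> \<iota> ?B))"
  proof -
    have "?d \<otimes> \<iota> ?B = (\<iota> ?H \<otimes> Braid C ?H ?H \<otimes> \<iota> (?H \<odot> ?B)) \<cdot>
      ((\<delta> H \<otimes> \<iota> ?H \<otimes> \<iota> (?H \<odot> ?B)) \<cdot> (\<iota> ?H \<otimes> (\<delta> H \<otimes> \<iota> ?B)))"
    proof -
      have "(\<delta> H \<otimes> \<iota> ?H \<otimes> \<iota> (?H \<odot> ?B)) \<cdot> (\<iota> ?H \<otimes> (\<delta> H \<otimes> \<iota> ?B)) = (\<delta> H \<otimes> \<delta> H) \<otimes> \<iota> ?B"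
        using hb by (simp add: hom_iff Tens_assoc interchange Tens_Id)
      moreover have "\<iota> ?H \<otimes> Braid C ?H ?H \<otimes> \<iota> (?H \<odot> ?B) = (\<iota> ?H \<otimes> Braid C ?H ?H \<otimes> \<iota> ?H) \<otimes> \<iota> ?B"
        using hb by (simp add: hom_iff Tens_assoc Id_Tens)
      ultimately show ?thesis
        using hb by (simp add: hom_iff interchange)
    qed
    then show ?thesis
      using hb \<Phi>_hom by (simp add: star_def theta_def hom_iff)
  qed
  \<comment> \<open>\<open>u_mult\<close> expands \<open>u (h\<^sub>1 k\<^sub>1)\<close>, and the
    resulting outer factor \<open>u\<close> is moved in front of the whole product.\<close>
  also have "th ?H (?H \<odot> ?B) (u \<cdot> \<mu> H) ?\<Psi> = st (?H \<odot> (?H \<odot> ?B)) u (th ?H (?H \<odot> ?B) (\<Phi> \<cdot> (\<iota> ?H \<otimes> u)) ?\<Psi>)"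
    unfolding u_mult
    using hb \<Phi>_hom \<Psi> h(12) b(9) by (intro star_theta [symmetric]) (auto simp: hom_iff)
  \<comment> \<open>Taking \<open>u\<close> and \<open>\<Phi>\<close> out of the arguments leaves a
    product of two values of \<open>\<Phi>\<close>, to which multiplicativity applies.\<close>
  also have "th ?H (?H \<odot> ?B) (\<Phi> \<cdot> (\<iota> ?H \<otimes> u)) ?\<Psi> = th ?B ?B \<Phi> \<Phi> \<cdot> (\<iota> ?H \<otimes> u \<otimes> \<Phi>)"
    using hb \<Phi>_hom by (intro theta_comp [symmetric]) (auto simp: hom_iff)
  also have "\<dots> = \<Phi> \<cdot> (\<iota> ?H \<otimes> (\<mu> B \<cdot> (u \<otimes> \<Phi>)))"
    unfolding \<Phi>_module_algebra_mult [symmetric] using hb \<Phi>_hom by (simp add: hom_iff interchange Tens_assoc)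
  also have "st (?H \<odot> (?H \<odot> ?B)) u \<dots> = st ?B u \<Phi> \<cdot> (\<iota> ?H \<otimes> (\<mu> B \<cdot> (u \<otimes> \<Phi>)))"
    using hb \<Phi>_hom by (subst star_comp) (auto simp: hom_iff Tens_Id)
  also have "\<dots> \<cdot> (\<iota> ?H \<otimes> (\<delta> H \<otimes> \<iota> ?B)) = \<phi> \<cdot> (\<iota> ?H \<otimes> (\<mu> B \<cdot> ((u \<otimes> \<Phi>) \<cdot> (\<delta> H \<otimes> \<iota> ?B))))"
    unfolding star_u_\<Phi> using hb \<Phi>_hom by (simp add: hom_iff interchange)
  \<comment> \<open>The inner convolution is again \<open>u\<close> acting on \<open>\<Phi>\<close>,
    that is \<open>\<phi>\<close>.\<close>
  also have "\<dots> = \<phi> \<cdot> (\<mu> H \<otimes> \<iota> ?B)"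
    by (simp only: star_u_\<Phi> [unfolded star_def] \<phi>_mult)
  finally have *: "star (\<mu> B) ?d ?B (u \<cdot> \<mu> H) ?\<Psi> = \<phi> \<cdot> (\<mu> H \<otimes> \<iota> ?B)" .
  \<comment> \<open>Cancelling \<open>u \<cdot> \<mu> H\<close> leaves what turns out to be
    \<open>\<Phi>\<close> pulled back along the coalgebra morphism \<open>\<mu> H\<close>.\<close>
  have "?\<Psi> = star (\<mu> B) ?d ?B (antipode B \<cdot> (u \<cdot> \<mu> H)) (\<phi> \<cdot> (\<mu> H \<otimes> \<iota> ?B))"
    unfolding * [symmetric] by (rule star_antipode(1) [OF hopf(2) c u\<mu> b(1) \<Psi>, symmetric])
  also have "\<dots> = star (\<mu> B) ?d ?B ((antipode B \<cdot> u) \<cdot> \<mu> H) (\<phi> \<cdot> (\<mu> H \<otimes> \<iota> ?B))"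
    using hb by (simp add: hom_iff)
  also have "\<dots> = \<Phi> \<cdot> (\<mu> H \<otimes> \<iota> ?B)"
    unfolding \<Phi>_star using hb \<mu> d by (intro star_comp [symmetric]) (auto simp: hom_iff)
  finally show ?thesis .
qed

lemma one_cocycle: "one_cocycle C (H, B, \<Phi>, u)"
proof -
  have "algebra C (alg B)"
    using hopf(2) by (simp add: hopf_algebra_def)
  moreover have "left_module C H (ob B) \<Phi>"
    using b(1) \<Phi>_hom \<Phi>_unit \<Phi>_mult by (simp add: left_module_def)
  moreover have "th (ob B) (ob B) \<Phi> \<Phi> = \<mu> B \<cdot> (\<Phi> \<otimes> \<Phi>) \<cdot>
      (\<iota> (ob H) \<otimes> Braid C (ob H) (ob B) \<otimes> \<iota> (ob B)) \<cdot> (\<delta> H \<otimes> \<iota> (ob B) \<otimes> \<iota> (ob B))"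
    using hb \<Phi>_hom by (simp add: theta_def hom_iff)
  ultimately have "left_module_algebra C H (alg B) \<Phi>"
    using \<Phi>_module_algebra_unit \<Phi>_module_algebra_mult by (simp add: alg_def)
  then show ?thesis
    using hopf u_coalgebra_morphism cocycle by (simp add: coalg_def)
qed

end

section \<open>Morphisms of bracoids as morphisms of 1-cocycles\<close>

text \<open>\<open>u_map\<close> and \<open>Phi_map\<close> are built from the action and the Hopf
  algebra structure; \<open>f\<close> and \<open>g\<close> respect all of these, the antipode by
  \<open>hopf_morphism_antipode\<close>.\<close>

lemma (in plain_braided_category) bracoid_morphism_cocycle_morphism:
  assumes "coalgebraic_bracoid C H B \<phi>" "coalgebraic_bracoid C H' B' \<phi>'"
    and m: "bracoid_morphism C (H, B, \<phi>) (H', B', \<phi>') (f, g)"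
  shows "cocycle_morphism C (H, B, Phi_map C H B \<phi>, u_map C H B \<phi>)
    (H', B', Phi_map C H' B' \<phi>', u_map C H' B' \<phi>') (f, g)"
proof -
  interpret X: coalgebraic_bracoid C H B \<phi> by fact
  interpret Y: coalgebraic_bracoid C H' B' \<phi>' by fact
  have f: "hopf_morphism C H H' f" and g: "hopf_morphism C B B' g" and \<phi>: "g \<cdot> \<phi> = \<phi>' \<cdot> (f \<otimes> g)"
    using m by auto
  have fg: "f \<in> hom C (ob H) (ob H')" "g \<in> hom C (ob B) (ob B')"
    and f': "\<delta> H' \<cdot> f = (f \<otimes> f) \<cdot> \<delta> H"
    and g': "g \<cdot> \<eta> B = \<eta> B'" "g \<cdot> \<mu> B = \<mu> B' \<cdot> (g \<otimes> g)"
    using f g by (auto simp: hopf_morphism_def alg_def coalg_def)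
  have \<lambda>: "g \<cdot> antipode B = antipode B' \<cdot> g"
    using hopf_morphism_antipode [OF X.hopf(2) Y.hopf(2) g] .
  note hb = X.hb Y.hb X.\<Phi>_hom Y.\<Phi>_hom fg
  have u: "Y.u \<cdot> f = g \<cdot> X.u"
  proof -
    have "g \<cdot> X.u = (g \<cdot> \<phi>) \<cdot> (\<iota> (ob H) \<otimes> \<eta> B)"
      using hb by (simp add: u_map_def hom_iff)
    also have "\<dots> = \<phi>' \<cdot> (f \<otimes> (g \<cdot> \<eta> B))"
      unfolding \<phi> using hb by (simp add: hom_iff interchange)
    also have "\<dots> = \<phi>' \<cdot> ((\<iota> (ob H') \<otimes> \<eta> B') \<cdot> (f \<otimes> \<iota> \<K>))"
      unfolding g' using hb by (simp add: hom_iff interchange del: Tens_Unit)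
    finally show ?thesis
      using hb by (simp add: u_map_def hom_iff)
  qed
  have "g \<cdot> X.\<Phi> = (g \<cdot> \<mu> B) \<cdot> (((antipode B \<cdot> X.u) \<otimes> \<phi>) \<cdot> (\<delta> H \<otimes> \<iota> (ob B)))"
    using hb by (simp add: X.\<Phi>_star star_def hom_iff)
  also have "\<dots> = \<mu> B' \<cdot> (((g \<cdot> antipode B \<cdot> X.u) \<otimes> (g \<cdot> \<phi>)) \<cdot> (\<delta> H \<otimes> \<iota> (ob B)))"
    unfolding g' using hb by (simp add: hom_iff interchange interchange_assoc)
  also have "g \<cdot> antipode B \<cdot> X.u = antipode B' \<cdot> (g \<cdot> X.u)"
    unfolding \<lambda> using hb by (simp add: hom_iff)
  also have "\<dots> = (antipode B' \<cdot> Y.u) \<cdot> f"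
    unfolding u [symmetric] using hb by (simp add: hom_iff)
  also have "\<mu> B' \<cdot> ((\<dots> \<otimes> (g \<cdot> \<phi>)) \<cdot> (\<delta> H \<otimes> \<iota> (ob B))) = Y.\<Phi> \<cdot> (f \<otimes> g)"
  proof -
    \<comment> \<open>\<open>f\<close> is comultiplicative, so it passes into both factors of the
      convolution.\<close>
    have "Y.\<Phi> \<cdot> (f \<otimes> g) = star (\<mu> B') (\<delta> H) (ob B) ((antipode B' \<cdot> Y.u) \<cdot> f) (\<phi>' \<cdot> (f \<otimes> g))"
      unfolding Y.\<Phi>_star using hb f' by (intro star_comp) (auto simp: hom_iff)
    then show ?thesis
      by (simp add: star_def \<phi>)
  qed
  finally show ?thesis
    using f g u by simp
qed

section \<open>The categories of bracoids and of 1-cocycles\<close>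

text \<open>The category laws hold componentwise in \<open>C\<close>, so only closure under
  identities and composition depends on the notion of morphism.\<close>

lemma (in plain_braided_category) category_pair_category:
  assumes Id: "\<And>X. is_obj X \<Longrightarrow> is_mor X X (\<iota> (ob (fst (HB X))), \<iota> (ob (snd (HB X))))"
    and Comp: "\<And>X Y Z f g f' g'. \<lbrakk>is_obj X; is_obj Y; is_obj Z; is_mor X Y (f, g); is_mor Y Z (f', g')\<rbrakk>
      \<Longrightarrow> is_mor X Z (f' \<cdot> f, g' \<cdot> g)"
    and hom: "\<And>X Y f g. \<lbrakk>is_obj X; is_obj Y; is_mor X Y (f, g)\<rbrakk>
      \<Longrightarrow> f \<in> hom C (ob (fst (HB X))) (ob (fst (HB Y))) \<and> g \<in> hom C (ob (snd (HB X))) (ob (snd (HB Y)))"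
  shows "category (pair_category C HB is_obj is_mor)"
proof -
  let ?D = "pair_category C HB is_obj is_mor"
  have homD: "\<exists>f g. x = (X, (f, g), Y) \<and> is_obj X \<and> is_obj Y \<and> is_mor X Y (f, g)
      \<and> f \<in> hom C (ob (fst (HB X))) (ob (fst (HB Y))) \<and> g \<in> hom C (ob (snd (HB X))) (ob (snd (HB Y)))"
    if "x \<in> hom ?D X Y" for x X Y
    using that hom by (fastforce simp: hom_def pair_category_def)
  show ?thesis
  proof
    fix x
    assume "x \<in> Arr ?D"
    then show "Dom ?D x \<in> Obj ?D" "Cod ?D x \<in> Obj ?D"
      by (auto simp: pair_category_def)
  next
    fix X
    assume "X \<in> Obj ?D"
    then show "Id ?D X \<in> hom ?D X X"
      using Id by (simp add: pair_category_def hom_def)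
  next
    fix x X Y y Z
    assume "x \<in> hom ?D X Y" "y \<in> hom ?D Y Z"
    then show "Comp ?D y x \<in> hom ?D X Z"
      using homD [of x X Y] homD [of y Y Z] Comp [of X Y Z]
      by (auto simp: pair_category_def hom_def)
  next
    fix x X Y
    assume "x \<in> hom ?D X Y"
    then show "Comp ?D x (Id ?D X) = x" "Comp ?D (Id ?D Y) x = x"
      using homD [of x X Y] by (auto simp: pair_category_def Comp_Id Id_Comp)
  next
    fix x X Y y Z z W
    assume "x \<in> hom ?D X Y" "y \<in> hom ?D Y Z" "z \<in> hom ?D Z W"
    then show "Comp ?D (Comp ?D z y) x = Comp ?D z (Comp ?D y x)"
      using homD [of x X Y] homD [of y Y Z] homD [of z Z W]
      by (auto simp: pair_category_def intro: Comp_assoc)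
  qed
qed

lemma category_full_subcategory:
  assumes "category D"
  shows "category (full_subcategory D P)"
proof -
  interpret category D by fact
  show ?thesis
    by unfold_locales
      (use Dom_Obj Cod_Obj Id_hom Comp_hom Comp_Id Id_Comp Comp_assoc in
        \<open>fastforce simp: full_subcategory_def hom_def\<close>)+
qed

context plain_braided_category
begin

lemma hopf_morphism_Id: "hopf_algebra C X \<Longrightarrow> hopf_morphism C X X (\<iota> (ob X))"
  using hopf_algebraD [of X]
  by (simp add: hopf_morphism_def alg_def coalg_def hom_iff Tens_Id)

lemma hopf_morphism_comp:
  assumes "hopf_algebra C X" "hopf_algebra C Y" "hopf_algebra C Z"
    and f: "hopf_morphism C X Y f" and g: "hopf_morphism C Y Z g"
  shows "hopf_morphism C X Z (g \<cdot> f)"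
proof -
  note x = hopf_algebraD(1-6) [OF assms(1)] and y = hopf_algebraD(1-6) [OF assms(2)]
    and z = hopf_algebraD(1-6) [OF assms(3)]
  have H: "f \<in> hom C (ob X) (ob Y)" "g \<in> hom C (ob Y) (ob Z)"
    and *: "f \<cdot> \<eta> X = \<eta> Y" "g \<cdot> \<eta> Y = \<eta> Z"
      "f \<cdot> \<mu> X = \<mu> Y \<cdot> (f \<otimes> f)" "g \<cdot> \<mu> Y = \<mu> Z \<cdot> (g \<otimes> g)"
    using f g by (auto simp: hopf_morphism_def alg_def)
  have "(g \<cdot> f) \<cdot> \<mu> X = (g \<cdot> \<mu> Y) \<cdot> (f \<otimes> f)"
    using H x y z by (simp add: hom_iff *(3))
  then have "(g \<cdot> f) \<cdot> \<mu> X = \<mu> Z \<cdot> ((g \<cdot> f) \<otimes> (g \<cdot> f))"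
    unfolding *(4) using H x y z by (simp add: hom_iff interchange)
  then have "algebra_morphism C (alg X) (alg Z) (g \<cdot> f)"
    using H x y z * by (simp add: alg_def hom_iff)
  moreover have "coalgebra_morphism C (coalg X) (coalg Z) (g \<cdot> f)"
    using f g x y z unfolding hopf_morphism_def coalg_def
    by (intro coalgebra_morphism_comp [where Q = "ob Y"]) auto
  ultimately show ?thesis
    by (simp add: hopf_morphism_def)
qed

lemma hopf_morphism_hom: "hopf_morphism C X Y f \<Longrightarrow> f \<in> hom C (ob X) (ob Y)"
  by (simp add: hopf_morphism_def alg_def)

text \<open>Serves both categories: the action is \<open>\<phi>\<close> for bracoids and
  \<open>\<gamma>\<close> for 1-cocycles.\<close>

lemma intertwiner_comp:
  assumes "g \<cdot> \<phi> = \<phi>' \<cdot> (f \<otimes> g)" "g' \<cdot> \<phi>' = \<phi>'' \<cdot> (f' \<otimes> g')"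
    "f \<in> hom C H H'" "g \<in> hom C B B'" "f' \<in> hom C H' H''" "g' \<in> hom C B' B''"
    "\<phi> \<in> hom C (H \<odot> B) B" "\<phi>' \<in> hom C (H' \<odot> B') B'" "\<phi>'' \<in> hom C (H'' \<odot> B'') B''"
  shows "(g' \<cdot> g) \<cdot> \<phi> = \<phi>'' \<cdot> ((f' \<cdot> f) \<otimes> (g' \<cdot> g))"
proof -
  have "(g' \<cdot> g) \<cdot> \<phi> = (g' \<cdot> \<phi>') \<cdot> (f \<otimes> g)"
    using assms(1,3-) by (simp add: hom_iff)
  then show ?thesis
    using assms(2-) by (simp add: hom_iff interchange)
qed

lemma category_HBrcd: "category (HBrcd C)"
  unfolding HBrcd_def
proof (rule category_pair_category)
  fix X :: "('o, 'a) hopf \<times> ('o, 'a) hopf \<times> 'a"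
  assume X: "hopf_bracoid C X"
  obtain H B \<phi> where "X = (H, B, \<phi>)" by (cases X)
  then show "bracoid_morphism C X X (\<iota> (ob (fst (case X of (H, B, \<phi>) \<Rightarrow> (H, B)))),
      \<iota> (ob (snd (case X of (H, B, \<phi>) \<Rightarrow> (H, B)))))"
    using X hopf_algebraD(1) [of H] hopf_algebraD(1) [of B]
    by (auto simp: hopf_morphism_Id left_module_def hom_iff Tens_Id)
next
  fix X Y Z :: "('o, 'a) hopf \<times> ('o, 'a) hopf \<times> 'a" and f g f' g'
  assume a: "hopf_bracoid C X" "hopf_bracoid C Y" "hopf_bracoid C Z"
    "bracoid_morphism C X Y (f, g)" "bracoid_morphism C Y Z (f', g')"
  obtain H B \<phi> H' B' \<phi>' H'' B'' \<phi>''
    where "X = (H, B, \<phi>)" "Y = (H', B', \<phi>')" "Z = (H'', B'', \<phi>'')" by (metis prod_cases3)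
  then show "bracoid_morphism C X Z (f' \<cdot> f, g' \<cdot> g)"
    using a intertwiner_comp [of g \<phi> \<phi>' f g' \<phi>'' f' "ob H" "ob H'" "ob B" "ob B'" "ob H''" "ob B''"]
    by (auto intro: hopf_morphism_comp [of H H' H''] hopf_morphism_comp [of B B' B'']
        simp: left_module_def hopf_morphism_hom)
qed (auto simp: hopf_morphism_hom)

lemma category_OneCocycle: "category (OneCocycle C)"
  unfolding OneCocycle_def
proof (rule category_pair_category)
  fix X :: "('o, 'a) hopf \<times> ('o, 'a) hopf \<times> 'a \<times> 'a"
  assume X: "one_cocycle C X"
  obtain H B \<gamma> \<pi> where "X = (H, B, \<gamma>, \<pi>)" by (cases X)
  then show "cocycle_morphism C X X (\<iota> (ob (fst (case X of (H, B, \<gamma>, \<pi>) \<Rightarrow> (H, B)))),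
      \<iota> (ob (snd (case X of (H, B, \<gamma>, \<pi>) \<Rightarrow> (H, B)))))"
    using X hopf_algebraD(1) [of H] hopf_algebraD(1) [of B]
    by (auto simp: hopf_morphism_Id alg_def coalg_def left_module_def hom_iff Tens_Id)
next
  fix X Y Z :: "('o, 'a) hopf \<times> ('o, 'a) hopf \<times> 'a \<times> 'a" and f g f' g'
  assume a: "one_cocycle C X" "one_cocycle C Y" "one_cocycle C Z"
    "cocycle_morphism C X Y (f, g)" "cocycle_morphism C Y Z (f', g')"
  obtain H B \<gamma> \<pi> H' B' \<gamma>' \<pi>' H'' B'' \<gamma>'' \<pi>''
    where X: "X = (H, B, \<gamma>, \<pi>)" "Y = (H', B', \<gamma>', \<pi>')" "Z = (H'', B'', \<gamma>'', \<pi>'')" by (metis prod_cases4)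
  have m: "hopf_morphism C H H' f" "hopf_morphism C B B' g" "hopf_morphism C H' H'' f'" "hopf_morphism C B' B'' g'"
    using a X by auto
  have \<pi>: "\<pi> \<in> hom C (ob H) (ob B)" "\<pi>' \<in> hom C (ob H') (ob B')" "\<pi>'' \<in> hom C (ob H'') (ob B'')"
    and sq: "\<pi>' \<cdot> f = g \<cdot> \<pi>" "\<pi>'' \<cdot> f' = g' \<cdot> \<pi>'"
    using a X by (auto simp: coalg_def)
  note t = \<pi> m [THEN hopf_morphism_hom]
  \<comment> \<open>The two commutative squares in \<open>sq\<close> are pasted.\<close>
  have "\<pi>'' \<cdot> (f' \<cdot> f) = (\<pi>'' \<cdot> f') \<cdot> f"
    using t by (simp add: hom_iff)
  also have "\<dots> = g' \<cdot> (\<pi>' \<cdot> f)"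
    unfolding sq(2) using t by (simp add: hom_iff)
  also have "\<dots> = (g' \<cdot> g) \<cdot> \<pi>"
    unfolding sq(1) using t by (simp add: hom_iff)
  finally have "\<pi>'' \<cdot> (f' \<cdot> f) = (g' \<cdot> g) \<cdot> \<pi>" .
  then show "cocycle_morphism C X Z (f' \<cdot> f, g' \<cdot> g)"
    using a X m intertwiner_comp [of g \<gamma> \<gamma>' f g' \<gamma>'' f' "ob H" "ob H'" "ob B" "ob B'" "ob H''" "ob B''"]
    by (auto intro: hopf_morphism_comp [of H H' H''] hopf_morphism_comp [of B B' B'']
        simp: left_module_def alg_def hopf_morphism_hom)
qed (auto simp: hopf_morphism_hom)

section \<open>The full subcategory and the functor\<close>

lemma Obj_HBrcd_bar: "(H, B, \<phi>) \<in> Obj (HBrcd_bar C) \<longleftrightarrow> coalgebraic_bracoid C H B \<phi>"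
  using plain_braided_category_axioms
  by (auto simp: HBrcd_bar_def HBrcd_def full_subcategory_def pair_category_def
      coalgebraic_bracoid_def coalgebraic_bracoid_axioms_def)

text \<open>Fullness: the coalgebra condition restricts only the objects.\<close>

lemma Arr_HBrcd_bar: "(X, (f, g), Y) \<in> Arr (HBrcd_bar C) \<longleftrightarrow>
    X \<in> Obj (HBrcd_bar C) \<and> Y \<in> Obj (HBrcd_bar C) \<and> bracoid_morphism C X Y (f, g)"
  by (auto simp: HBrcd_bar_def HBrcd_def full_subcategory_def pair_category_def)

end

theorem theorem3p6:
  fixes C :: "('o, 'a) braided_category"
  assumes "strict_braided_monoidal_category C"
  shows "\<exists>Go Ga. cat_functor (HBrcd_bar C) (OneCocycle C) Go Ga
    \<and> (\<forall>H B \<phi>. (H, B, \<phi>) \<in> Obj (HBrcd_bar C)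
          \<longrightarrow> Go (H, B, \<phi>) = (H, B, Phi_map C H B \<phi>, u_map C H B \<phi>))
    \<and> (\<forall>X f g Y. (X, (f, g), Y) \<in> Arr (HBrcd_bar C)
          \<longrightarrow> Ga (X, (f, g), Y) = (Go X, (f, g), Go Y))"
proof -
  interpret plain_braided_category C
    using assms by (simp add: plain_braided_category_def)
  let ?D = "HBrcd_bar C" and ?E = "OneCocycle C"
  define Go where "Go = (\<lambda>(H, B, \<phi>). (H, B, Phi_map C H B \<phi>, u_map C H B \<phi>))"
  \<comment> \<open>Arrows carry their source and target, so acting as the identity on pairs still
    means retagging them.\<close>
  define Ga :: "_ \<times> ('a \<times> 'a) \<times> _ \<Rightarrow> _" where "Ga = (\<lambda>(X, fg, Y). (Go X, fg, Go Y))"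
  interpret D: category ?D
    unfolding HBrcd_bar_def by (intro category_full_subcategory category_HBrcd)
  interpret E: category ?E
    by (rule category_OneCocycle)
  have Go: "one_cocycle C (Go X)" if "X \<in> Obj ?D" for X
    using that coalgebraic_bracoid.one_cocycle by (cases X) (simp add: Go_def Obj_HBrcd_bar del: one_cocycle.simps)
  have hom: "\<exists>f g. x = (X, (f, g), Y) \<and> X \<in> Obj ?D \<and> Y \<in> Obj ?D \<and> bracoid_morphism C X Y (f, g)"
    if "x \<in> hom ?D X Y" for x X Y
  proof -
    have "Dom ?D x = fst x" "Cod ?D x = snd (snd x)"
      by (auto simp: HBrcd_bar_def HBrcd_def full_subcategory_def pair_category_def split: prod.splits)
    moreover have "Dom ?D x = X" "Cod ?D x = Y"
      using that by (auto simp: hom_def)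
    ultimately obtain fg where "x = (X, fg, Y)"
      by (metis prod.collapse)
    then show ?thesis
      using that by (cases fg) (simp add: hom_def Arr_HBrcd_bar)
  qed
  have "cat_functor ?D ?E Go Ga"
  proof
    fix X
    assume X: "X \<in> Obj ?D"
    then show "Go X \<in> Obj ?E"
      using Go by (simp add: OneCocycle_def pair_category_def)
    \<comment> \<open>\<open>Go\<close> keeps the two Hopf algebras, so both identity arrows consist
      of the same pair.\<close>
    show "Ga (Id ?D X) = Id ?E (Go X)"
      by (cases X) (simp add: Ga_def Go_def HBrcd_bar_def HBrcd_def OneCocycle_def
          full_subcategory_def pair_category_def)
  next
    fix x X Y
    assume "x \<in> hom ?D X Y"
    then obtain f g where x: "x = (X, (f, g), Y)" "X \<in> Obj ?D" "Y \<in> Obj ?D" "bracoid_morphism C X Y (f, g)"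
      using hom by blast
    then have "cocycle_morphism C (Go X) (Go Y) (f, g)"
      using bracoid_morphism_cocycle_morphism
      by (cases X; cases Y) (simp add: Go_def Obj_HBrcd_bar del: bracoid_morphism.simps cocycle_morphism.simps)
    then show "Ga x \<in> hom ?E (Go X) (Go Y)"
      using x Go by (simp add: hom_def Ga_def OneCocycle_def pair_category_def)
  next
    fix x X Y y Z
    assume "x \<in> hom ?D X Y" "y \<in> hom ?D Y Z"
    then obtain f g f' g' where "x = (X, (f, g), Y)" "y = (Y, (f', g'), Z)"
      using hom by blast
    then show "Ga (Comp ?D y x) = Comp ?E (Ga y) (Ga x)"
      by (simp add: Ga_def HBrcd_bar_def HBrcd_def OneCocycle_def full_subcategory_def pair_category_def)
  qed
  then show ?thesis
    by (intro exI [of _ Go] exI [of _ Ga]) (simp add: Go_def Ga_def)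
qed

end
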